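(* Let $T$ be a monoid, $Y$ a semilattice, and $\alpha:T\to TI_Y$ a monoidal subhomomorphism (that is, $T$ sub-acts on $Y$ by isomorphisms between ideals). Then $W=W(T,Y)$ is isomorphic to the semigroup $(T_Y)_{T,TI_Y}=\{(\beta,t)\in T_Y\times T:\beta\le t\alpha\text{ in }TI_Y\}$ and so is a proper restriction semigroup, with $P_W\cong Y$ and $W/\sigma\cong T$; it is almost $T$-proper if and only if $\alpha$ is a homomorphism. Further, if $Y$ is a monoid (has an identity) and $\alpha$ is a subhomomorphism into $T_Y$ (that is, $T$ sub-acts on $Y$ by isomorphisms between principal ideals), then $W$ is isomorphic to the monoid $(T_Y)_T=\{(\beta,t)\in T_Y\times T:\beta\le t\alpha\text{ in }T_Y\}$ and so is an $F$-restriction monoid; it is $T$-proper if and only if $\alpha$ is a homomorphism.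
   Context: A restriction semigroup is an algebra $(S,\cdot,{}^+,{}^* )$ with $(S,\cdot)$ a semigroup, satisfying $x^+x=x$, $(x^+y)^+=x^+y^+$, $x^+y^+=y^+x^+$, $xy^+=(xy)^+x$, the dual identities $xx^*=x$, $(yx^* )^*=y^*x^*$, $y^*x^*=x^*y^*$, $y^*x=x(yx)^*$, and $(x^+)^*=x^+$, $(x^* )^+=x^*$. Its projections form the semilattice $P_S=\{x^+:x\in S\}=\{x^*:x\in S\}$. A restriction monoid is a restriction semigroup with identity $1$ (so $1^+=1^*=1$). A plain monoid is regarded as a restriction monoid by setting $a^+=a^*=1$ for all $a$; an inverse semigroup is regarded as a restriction semigroup via $x^+=xx^{-1}$, $x^*=x^{-1}x$. The natural partial order is $a\le b$ iff $a=eb$ for some $e\in P_S$; order ideals are nonempty downward-closed subsets. Relations on $S$: $a\mathrel{\mathbb R}b$ iff $a^+=b^+$; $a\mathrel{\mathbb L}b$ iff $a^*=b^*$; $\sigma=\{(a,b): ea=eb\text{ for some }e\in P_S\}$ is the least congruence identifying all projections. $S$ is proper if $\mathbb R\cap\sigma$ and $\mathbb L\cap\sigma$ are both the identity relation. A restriction monoid is $F$-restriction if it is proper and every $\sigma$-class has a greatest element. A restriction monoid $M$ is $T$-proper, for a monoid $T$, if it has a plain submonoid $T'\cong T$ with $M=P_MT'$ such that $\sigma$ separates $T'$. A permissible subset of $S$ is an order ideal $A$ with $a^+b=b^+a$ and $ab^*=ba^*$ for all $a,b\in A$; the set $C(S)$ of permissible subsets is a restriction monoid under multiplication of subsets, with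 $A^+=\{a^+:a\in A\}$, $A^*=\{a^*:a\in A\}$ and identity $P_S$. $S$ is almost $T$-proper if $C(S)$ is $T$-proper. For a semilattice $Y$, ideals are nonempty downward-closed subsets. $TI_Y$ is the inverse monoid of all isomorphisms between ideals of $Y$, under composition of partial maps (written on the right, composed left to right); its natural partial order is restriction of partial maps. $T_Y$ is its inverse subsemigroup of isomorphisms between principal ideals. A monoidal subhomomorphism from a plain monoid $T$ to $TI_Y$ is a map $\alpha$ with $1\alpha=1$ and $(t\alpha)(u\alpha)\le(tu)\alpha$ for all $t,u$. Write $\Delta t,\nabla t$ for the domain and range of $t\alpha$, and $e^t=e(t\alpha)$ for $e\in\Delta t$. Then $$W(T,Y)=\{(t,e^t)\in T\times Y: e\in\Delta t\}=\{(t,f)\in T\times Y: f\in\nabla t\},$$ with $(t,e^t)(u,f^u)=(tu,(e^tf)^u)$, $(t,e^t)^+=(1,e)$, $(t,f)^*=(1,f)$. The sets $(T_Y)_{T,TI_Y}$ and $(T_Y)_T$ are regarded as restriction subsemigroups of $T_Y\times T$. *)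

theory Defs
  imports "HOL-Algebra.Group" "HOL-Algebra.Lattice"
begin

section \<open>Restriction semigroups\<close>

record 'a rsg = "'a partial_object" +
  rmult :: "'a \<Rightarrow> 'a \<Rightarrow> 'a"  (infixl "\<cdot>\<index>" 70)
  rplus :: "'a \<Rightarrow> 'a"
  rstar :: "'a \<Rightarrow> 'a"

locale restriction_semigroup =
  fixes S :: "('a, 'b) rsg_scheme" (structure)
  assumes nonempty: "carrier S \<noteq> {}"
    and mult_closed: "\<lbrakk>x \<in> carrier S; y \<in> carrier S\<rbrakk> \<Longrightarrow> x \<cdot> y \<in> carrier S"
    and plus_closed: "x \<in> carrier S \<Longrightarrow> rplus S x \<in> carrier S"
    and star_closed: "x \<in> carrier S \<Longrightarrow> rstar S x \<in> carrier S"
    and assoc: "\<lbrakk>x \<in> carrier S; y \<in> carrier S; z \<in> carrier S\<rbrakk> \<Longrightarrow> x \<cdot> y \<cdot> z = x \<cdot> (y \<cdot> z)"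
    and plus_left: "x \<in> carrier S \<Longrightarrow> rplus S x \<cdot> x = x"
    and plus_mult: "\<lbrakk>x \<in> carrier S; y \<in> carrier S\<rbrakk>
          \<Longrightarrow> rplus S (rplus S x \<cdot> y) = rplus S x \<cdot> rplus S y"
    and plus_comm: "\<lbrakk>x \<in> carrier S; y \<in> carrier S\<rbrakk>
          \<Longrightarrow> rplus S x \<cdot> rplus S y = rplus S y \<cdot> rplus S x"
    and plus_ample: "\<lbrakk>x \<in> carrier S; y \<in> carrier S\<rbrakk>
          \<Longrightarrow> x \<cdot> rplus S y = rplus S (x \<cdot> y) \<cdot> x"
    and star_right: "x \<in> carrier S \<Longrightarrow> x \<cdot> rstar S x = x"
    and star_mult: "\<lbrakk>x \<in> carrier S; y \<in> carrier S\<rbrakk>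
          \<Longrightarrow> rstar S (y \<cdot> rstar S x) = rstar S y \<cdot> rstar S x"
    and star_comm: "\<lbrakk>x \<in> carrier S; y \<in> carrier S\<rbrakk>
          \<Longrightarrow> rstar S y \<cdot> rstar S x = rstar S x \<cdot> rstar S y"
    and star_ample: "\<lbrakk>x \<in> carrier S; y \<in> carrier S\<rbrakk>
          \<Longrightarrow> rstar S y \<cdot> x = x \<cdot> rstar S (y \<cdot> x)"
    and star_plus: "x \<in> carrier S \<Longrightarrow> rstar S (rplus S x) = rplus S x"
    and plus_star: "x \<in> carrier S \<Longrightarrow> rplus S (rstar S x) = rstar S x"

definition rsg_iso :: "('a, 'c) rsg_scheme \<Rightarrow> ('b, 'd) rsg_scheme \<Rightarrow> ('a \<Rightarrow> 'b) set" where
  "rsg_iso S R = {h. bij_betw h (carrier S) (carrier R) \<and>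
     (\<forall>x\<in>carrier S. \<forall>y\<in>carrier S. h (x \<cdot>\<^bsub>S\<^esub> y) = h x \<cdot>\<^bsub>R\<^esub> h y) \<and>
     (\<forall>x\<in>carrier S. h (rplus S x) = rplus R (h x)) \<and>
     (\<forall>x\<in>carrier S. h (rstar S x) = rstar R (h x))}"

definition rsg_isomorphic :: "('a, 'c) rsg_scheme \<Rightarrow> ('b, 'd) rsg_scheme \<Rightarrow> bool" where
  "rsg_isomorphic S R \<longleftrightarrow> rsg_iso S R \<noteq> {}"

definition projections :: "('a, 'b) rsg_scheme \<Rightarrow> 'a set" where
  "projections S = rplus S ` carrier S"

definition natural_le :: "('a, 'b) rsg_scheme \<Rightarrow> 'a \<Rightarrow> 'a \<Rightarrow> bool" where
  "natural_le S a b \<longleftrightarrow> (\<exists>e\<in>projections S. a = e \<cdot>\<^bsub>S\<^esub> b)"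

definition order_ideal :: "('a, 'b) rsg_scheme \<Rightarrow> 'a set \<Rightarrow> bool" where
  "order_ideal S A \<longleftrightarrow> A \<subseteq> carrier S \<and> A \<noteq> {} \<and>
     (\<forall>b\<in>A. \<forall>a\<in>carrier S. natural_le S a b \<longrightarrow> a \<in> A)"

definition R_rel :: "('a, 'b) rsg_scheme \<Rightarrow> ('a \<times> 'a) set" where
  "R_rel S = {(a, b). a \<in> carrier S \<and> b \<in> carrier S \<and> rplus S a = rplus S b}"

definition L_rel :: "('a, 'b) rsg_scheme \<Rightarrow> ('a \<times> 'a) set" where
  "L_rel S = {(a, b). a \<in> carrier S \<and> b \<in> carrier S \<and> rstar S a = rstar S b}"

definition sigma :: "('a, 'b) rsg_scheme \<Rightarrow> ('a \<times> 'a) set" where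
  "sigma S = {(a, b). a \<in> carrier S \<and> b \<in> carrier S \<and>
     (\<exists>e\<in>projections S. e \<cdot>\<^bsub>S\<^esub> a = e \<cdot>\<^bsub>S\<^esub> b)}"

definition proper :: "('a, 'b) rsg_scheme \<Rightarrow> bool" where
  "proper S \<longleftrightarrow> restriction_semigroup S \<and>
     R_rel S \<inter> sigma S = Id_on (carrier S) \<and> L_rel S \<inter> sigma S = Id_on (carrier S)"

text \<open>Operations on \<open>\<sigma>\<close>-classes; each union is a single class because
  \<open>\<sigma>\<close> is a congruence.\<close>

definition sigma_quotient :: "('a, 'b) rsg_scheme \<Rightarrow> 'a set rsg" where
  "sigma_quotient S = \<lparr> carrier = carrier S // sigma S,
     rmult = (\<lambda>A B. \<Union>a\<in>A. \<Union>b\<in>B. sigma S `` {a \<cdot>\<^bsub>S\<^esub> b}),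
     rplus = (\<lambda>A. \<Union>a\<in>A. sigma S `` {rplus S a}),
     rstar = (\<lambda>A. \<Union>a\<in>A. sigma S `` {rstar S a}) \<rparr>"

section \<open>Restriction monoids\<close>

definition is_identity :: "('a, 'b) rsg_scheme \<Rightarrow> 'a \<Rightarrow> bool" where
  "is_identity S u \<longleftrightarrow> u \<in> carrier S \<and> (\<forall>x\<in>carrier S. u \<cdot>\<^bsub>S\<^esub> x = x \<and> x \<cdot>\<^bsub>S\<^esub> u = x)"

definition restriction_monoid :: "('a, 'b) rsg_scheme \<Rightarrow> bool" where
  "restriction_monoid S \<longleftrightarrow> restriction_semigroup S \<and> (\<exists>u. is_identity S u)"

text \<open>The monoid underlying a restriction monoid, obtained by forgetting \<open>\<^sup>+\<close> and \<open>\<^sup>*\<close>.\<close>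

definition plain_reduct :: "('a, 'b) rsg_scheme \<Rightarrow> 'a monoid" where
  "plain_reduct S = \<lparr> carrier = carrier S, monoid.mult = rmult S, one = (THE u. is_identity S u) \<rparr>"

definition F_restriction :: "('a, 'b) rsg_scheme \<Rightarrow> bool" where
  "F_restriction M \<longleftrightarrow> restriction_monoid M \<and> proper M \<and>
     (\<forall>X\<in>carrier M // sigma M. \<exists>m\<in>X. \<forall>a\<in>X. natural_le M a m)"

text \<open>A plain submonoid is a submonoid with respect to multiplication and identity only: it
  need not be closed under \<open>\<^sup>+\<close> and \<open>\<^sup>*\<close>, nor need its elements satisfy
  \<open>a\<^sup>+ = a\<^sup>* = 1\<close>.\<close>

definition T_proper :: "('t, 'c) monoid_scheme \<Rightarrow> ('a, 'b) rsg_scheme \<Rightarrow> bool" where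
  "T_proper T M \<longleftrightarrow> restriction_monoid M \<and>
     (\<exists>T'. submonoid T' (plain_reduct M) \<and> (plain_reduct M)\<lparr>carrier := T'\<rparr> \<cong> T \<and>
        carrier M = {e \<cdot>\<^bsub>M\<^esub> t | e t. e \<in> projections M \<and> t \<in> T'} \<and>
        (\<forall>a\<in>T'. \<forall>b\<in>T'. (a, b) \<in> sigma M \<longrightarrow> a = b))"

definition permissible :: "('a, 'b) rsg_scheme \<Rightarrow> 'a set \<Rightarrow> bool" where
  "permissible S A \<longleftrightarrow> order_ideal S A \<and>
     (\<forall>a\<in>A. \<forall>b\<in>A. rplus S a \<cdot>\<^bsub>S\<^esub> b = rplus S b \<cdot>\<^bsub>S\<^esub> a \<and>
                        a \<cdot>\<^bsub>S\<^esub> rstar S b = b \<cdot>\<^bsub>S\<^esub> rstar S a)"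

definition C_monoid :: "('a, 'b) rsg_scheme \<Rightarrow> 'a set rsg" where
  "C_monoid S = \<lparr> carrier = {A. permissible S A},
     rmult = (\<lambda>A B. {a \<cdot>\<^bsub>S\<^esub> b | a b. a \<in> A \<and> b \<in> B}),
     rplus = (\<lambda>A. rplus S ` A),
     rstar = (\<lambda>A. rstar S ` A) \<rparr>"

definition almost_T_proper :: "('t, 'c) monoid_scheme \<Rightarrow> ('a, 'b) rsg_scheme \<Rightarrow> bool" where
  "almost_T_proper T S \<longleftrightarrow> restriction_semigroup S \<and> T_proper T (C_monoid S)"

section \<open>Plain monoids, inverse semigroups and products as restriction semigroups\<close>

definition plain_rsg :: "('t, 'c) monoid_scheme \<Rightarrow> 't rsg" where
  "plain_rsg T = \<lparr> carrier = carrier T, rmult = monoid.mult T,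
     rplus = (\<lambda>_. \<one>\<^bsub>T\<^esub>), rstar = (\<lambda>_. \<one>\<^bsub>T\<^esub>) \<rparr>"

definition semigroup_inverse :: "'a set \<Rightarrow> ('a \<Rightarrow> 'a \<Rightarrow> 'a) \<Rightarrow> 'a \<Rightarrow> 'a" where
  "semigroup_inverse A f x = (THE y. y \<in> A \<and> f (f x y) x = x \<and> f (f y x) y = y)"

definition inverse_rsg :: "'a set \<Rightarrow> ('a \<Rightarrow> 'a \<Rightarrow> 'a) \<Rightarrow> 'a rsg" where
  "inverse_rsg A f = \<lparr> carrier = A, rmult = f,
     rplus = (\<lambda>x. f x (semigroup_inverse A f x)),
     rstar = (\<lambda>x. f (semigroup_inverse A f x) x) \<rparr>"

definition rsg_prod :: "('a, 'c) rsg_scheme \<Rightarrow> ('b, 'd) rsg_scheme \<Rightarrow> ('a \<times> 'b) rsg" where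
  "rsg_prod S R = \<lparr> carrier = carrier S \<times> carrier R,
     rmult = (\<lambda>(a, b) (c, d). (a \<cdot>\<^bsub>S\<^esub> c, b \<cdot>\<^bsub>R\<^esub> d)),
     rplus = (\<lambda>(a, b). (rplus S a, rplus R b)),
     rstar = (\<lambda>(a, b). (rstar S a, rstar R b)) \<rparr>"

section \<open>Isomorphisms between ideals of a semilattice\<close>

definition semilattice_ideal :: "('y, 'w) gorder_scheme \<Rightarrow> 'y set \<Rightarrow> bool" where
  "semilattice_ideal Y I \<longleftrightarrow> I \<subseteq> carrier Y \<and> I \<noteq> {} \<and>
     (\<forall>y\<in>I. \<forall>x\<in>carrier Y. x \<sqsubseteq>\<^bsub>Y\<^esub> y \<longrightarrow> x \<in> I)"

definition principal_ideal :: "('y, 'w) gorder_scheme \<Rightarrow> 'y set \<Rightarrow> bool" where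
  "principal_ideal Y I \<longleftrightarrow> (\<exists>e\<in>carrier Y. I = {x \<in> carrier Y. x \<sqsubseteq>\<^bsub>Y\<^esub> e})"

definition TI_set :: "('y, 'w) gorder_scheme \<Rightarrow> ('y \<rightharpoonup> 'y) set" where
  "TI_set Y = {\<beta>. semilattice_ideal Y (dom \<beta>) \<and> semilattice_ideal Y (ran \<beta>) \<and>
     inj_on \<beta> (dom \<beta>) \<and>
     (\<forall>x\<in>dom \<beta>. \<forall>y\<in>dom \<beta>. the (\<beta> (x \<sqinter>\<^bsub>Y\<^esub> y)) = the (\<beta> x) \<sqinter>\<^bsub>Y\<^esub> the (\<beta> y))}"

definition TP_set :: "('y, 'w) gorder_scheme \<Rightarrow> ('y \<rightharpoonup> 'y) set" where
  "TP_set Y = {\<beta> \<in> TI_set Y. principal_ideal Y (dom \<beta>) \<and> principal_ideal Y (ran \<beta>)}"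

text \<open>Partial maps act on the right, so the left factor is applied first.\<close>

definition pcomp :: "('y \<rightharpoonup> 'y) \<Rightarrow> ('y \<rightharpoonup> 'y) \<Rightarrow> ('y \<rightharpoonup> 'y)" where
  "pcomp \<beta> \<gamma> = \<gamma> \<circ>\<^sub>m \<beta>"

definition TI_monoid :: "('y, 'w) gorder_scheme \<Rightarrow> ('y \<rightharpoonup> 'y) monoid" where
  "TI_monoid Y = \<lparr> carrier = TI_set Y, monoid.mult = pcomp, one = Some |` carrier Y \<rparr>"

text \<open>This is a monoid only if \<open>Y\<close> has a greatest element.\<close>

definition TP_monoid :: "('y, 'w) gorder_scheme \<Rightarrow> ('y \<rightharpoonup> 'y) monoid" where
  "TP_monoid Y = (TI_monoid Y)\<lparr>carrier := TP_set Y\<rparr>"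

definition TI_rsg :: "('y, 'w) gorder_scheme \<Rightarrow> ('y \<rightharpoonup> 'y) rsg" where
  "TI_rsg Y = inverse_rsg (TI_set Y) pcomp"

definition TP_rsg :: "('y, 'w) gorder_scheme \<Rightarrow> ('y \<rightharpoonup> 'y) rsg" where
  "TP_rsg Y = inverse_rsg (TP_set Y) pcomp"

definition monoidal_subhom ::
  "('t, 'c) monoid_scheme \<Rightarrow> ('y, 'w) gorder_scheme \<Rightarrow> ('t \<Rightarrow> ('y \<rightharpoonup> 'y)) \<Rightarrow> bool" where
  "monoidal_subhom T Y \<alpha> \<longleftrightarrow> \<alpha> \<in> carrier T \<rightarrow> TI_set Y \<and>
     \<alpha> \<one>\<^bsub>T\<^esub> = \<one>\<^bsub>TI_monoid Y\<^esub> \<and>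
     (\<forall>t\<in>carrier T. \<forall>u\<in>carrier T.
        natural_le (TI_rsg Y) (\<alpha> t \<otimes>\<^bsub>TI_monoid Y\<^esub> \<alpha> u) (\<alpha> (t \<otimes>\<^bsub>T\<^esub> u)))"

definition TP_T_TI ::
  "('t, 'c) monoid_scheme \<Rightarrow> ('y, 'w) gorder_scheme \<Rightarrow> ('t \<Rightarrow> ('y \<rightharpoonup> 'y)) \<Rightarrow> (('y \<rightharpoonup> 'y) \<times> 't) rsg" where
  "TP_T_TI T Y \<alpha> = (rsg_prod (TP_rsg Y) (plain_rsg T))
     \<lparr>carrier := {(\<beta>, t). \<beta> \<in> TP_set Y \<and> t \<in> carrier T \<and> natural_le (TI_rsg Y) \<beta> (\<alpha> t)}\<rparr>"

definition TP_T ::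
  "('t, 'c) monoid_scheme \<Rightarrow> ('y, 'w) gorder_scheme \<Rightarrow> ('t \<Rightarrow> ('y \<rightharpoonup> 'y)) \<Rightarrow> (('y \<rightharpoonup> 'y) \<times> 't) rsg" where
  "TP_T T Y \<alpha> = (rsg_prod (TP_rsg Y) (plain_rsg T))
     \<lparr>carrier := {(\<beta>, t). \<beta> \<in> TP_set Y \<and> t \<in> carrier T \<and> natural_le (TP_rsg Y) \<beta> (\<alpha> t)}\<rparr>"

section \<open>The construction \<open>W(T,Y)\<close>\<close>

text \<open>\<open>act \<alpha> e t\<close> is \<open>e\<^sup>t = e(t\<alpha>)\<close>, and \<open>act_pre \<alpha> f t\<close> is the unique \<open>e\<close> with \<open>e\<^sup>t = f\<close>.\<close>

definition act :: "('t \<Rightarrow> ('y \<rightharpoonup> 'y)) \<Rightarrow> 'y \<Rightarrow> 't \<Rightarrow> 'y" where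
  "act \<alpha> e t = the (\<alpha> t e)"

definition act_pre :: "('t \<Rightarrow> ('y \<rightharpoonup> 'y)) \<Rightarrow> 'y \<Rightarrow> 't \<Rightarrow> 'y" where
  "act_pre \<alpha> f t = (THE e. e \<in> dom (\<alpha> t) \<and> act \<alpha> e t = f)"

text \<open>The second factor \<open>(u, g)\<close> of a product is read as \<open>(u, f\<^sup>u)\<close> with \<open>f = act_pre \<alpha> g u\<close>.\<close>

definition W_rsg ::
  "('t, 'c) monoid_scheme \<Rightarrow> ('y, 'w) gorder_scheme \<Rightarrow> ('t \<Rightarrow> ('y \<rightharpoonup> 'y)) \<Rightarrow> ('t \<times> 'y) rsg" where
  "W_rsg T Y \<alpha> = \<lparr> carrier = {(t, act \<alpha> e t) | t e. t \<in> carrier T \<and> e \<in> dom (\<alpha> t)},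
     rmult = (\<lambda>(t, x) (u, g). (t \<otimes>\<^bsub>T\<^esub> u, act \<alpha> (x \<sqinter>\<^bsub>Y\<^esub> act_pre \<alpha> g u) u)),
     rplus = (\<lambda>(t, x). (\<one>\<^bsub>T\<^esub>, act_pre \<alpha> x t)),
     rstar = (\<lambda>(t, x). (\<one>\<^bsub>T\<^esub>, x)) \<rparr>"

end

theory Submission
  imports Defs
begin

text \<open>
  A restriction semigroup \<open>S\<close> is proper with \<open>S/\<sigma> \<cong> T\<close> as soon as it carries a surjection
  \<open>\<theta> : S \<rightarrow> T\<close> of restriction semigroups that is jointly injective with \<open>\<^sup>+\<close> and jointly
  injective with \<open>\<^sup>*\<close>: then \<open>b\<^sup>+a = a\<^sup>+b\<close> whenever \<open>a\<theta> = b\<theta>\<close>, so \<open>\<sigma>\<close> is the kernel of \<open>\<theta>\<close>. If moreover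
  the \<open>\<sigma>\<close>-class over \<open>t\<close> has a greatest element \<open>t\<mu>\<close>, then \<open>S\<close> is \<open>F\<close>-restriction, and
  it is \<open>T\<close>-proper exactly when \<open>\<mu>\<close> is multiplicative.

  For a set \<open>A\<close> of partial bijections closed under composition and inversion, the pairs \<open>(\<beta>, t)\<close>
  with \<open>\<beta> \<in> A\<close> and \<open>\<beta> \<le> t\<alpha>\<close> satisfy the first condition, and they satisfy the second one with
  \<open>t\<mu> = (t\<alpha>, t)\<close> if \<open>A\<close> contains every \<open>t\<alpha>\<close>. The choice \<open>A = T\<^sub>Y\<close> gives \<open>W(T,Y)\<close>. The
  permissible subsets of \<open>W(T,Y)\<close> are the sets \<open>{t} \<times> I\<close> with \<open>I\<close> an ideal contained in \<open>\<nabla>t\<close>,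
  so that \<open>C(W(T,Y))\<close> is obtained from \<open>A = TI\<^sub>Y\<close>.
\<close>

section \<open>Proper restriction semigroups as covers of a monoid\<close>

context restriction_semigroup
begin

lemma plus_plus: "x \<in> carrier S \<Longrightarrow> rplus S (rplus S x) = rplus S x"
  by (metis plus_closed plus_star star_plus)

lemma plus_idem: "x \<in> carrier S \<Longrightarrow> rplus S x \<cdot> rplus S x = rplus S x"
  by (metis plus_left plus_mult)

lemma projections_iff: "e \<in> projections S \<longleftrightarrow> e \<in> carrier S \<and> rplus S e = e"
  unfolding projections_def using plus_closed plus_plus by (metis (no_types, lifting) imageE imageI)

lemma projection_closed: "e \<in> projections S \<Longrightarrow> e \<in> carrier S"
  by (simp add: projections_iff)

lemma projection_idem: "e \<in> projections S \<Longrightarrow> e \<cdot> e = e"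
  by (metis plus_left projections_iff)

lemma projection_comm: "\<lbrakk>e \<in> projections S; f \<in> projections S\<rbrakk> \<Longrightarrow> e \<cdot> f = f \<cdot> e"
  by (metis plus_comm projections_iff)

lemma projection_mult: "\<lbrakk>e \<in> projections S; f \<in> projections S\<rbrakk> \<Longrightarrow> e \<cdot> f \<in> projections S"
  by (metis mult_closed plus_mult projections_iff)

lemma plus_in_projections: "x \<in> carrier S \<Longrightarrow> rplus S x \<in> projections S"
  by (simp add: projections_def)

lemma star_in_projections: "x \<in> carrier S \<Longrightarrow> rstar S x \<in> projections S"
  by (simp add: projections_iff star_closed plus_star)

lemma identity_unique: "\<lbrakk>is_identity S u; is_identity S v\<rbrakk> \<Longrightarrow> u = v"
  by (metis is_identity_def)

end

section \<open>Covers of a monoid and the congruence \<sigma>\<close>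

locale proper_cover = restriction_semigroup S + T: monoid T
  for S :: "('a, 'b) rsg_scheme" (structure)
    and T :: "('t, 'c) monoid_scheme" and \<theta> :: "'a \<Rightarrow> 't" +
  assumes cover_image: "\<theta> ` carrier S = carrier T"
    and cover_mult: "\<lbrakk>x \<in> carrier S; y \<in> carrier S\<rbrakk> \<Longrightarrow> \<theta> (x \<cdot> y) = \<theta> x \<otimes>\<^bsub>T\<^esub> \<theta> y"
    and cover_plus: "x \<in> carrier S \<Longrightarrow> \<theta> (rplus S x) = \<one>\<^bsub>T\<^esub>"
    and cover_star: "x \<in> carrier S \<Longrightarrow> \<theta> (rstar S x) = \<one>\<^bsub>T\<^esub>"
    and plus_inject: "\<lbrakk>x \<in> carrier S; y \<in> carrier S; rplus S x = rplus S y; \<theta> x = \<theta> y\<rbrakk> \<Longrightarrow> x = y"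
    and star_inject: "\<lbrakk>x \<in> carrier S; y \<in> carrier S; rstar S x = rstar S y; \<theta> x = \<theta> y\<rbrakk> \<Longrightarrow> x = y"
begin

lemma cover_closed: "x \<in> carrier S \<Longrightarrow> \<theta> x \<in> carrier T"
  using cover_image by auto

text \<open>A projection \<open>e\<close> equals \<open>rplus S e\<close>, so
  \<open>cover_plus\<close> sends it to the identity of \<open>T\<close>.\<close>

lemma cover_projection_mult:
  assumes "e \<in> projections S" "x \<in> carrier S" shows "\<theta> (e \<cdot> x) = \<theta> x"
  using assms by (metis cover_closed cover_mult cover_plus T.l_one projections_iff)

text \<open>Both sides have the same \<open>rplus\<close>, the product of the commuting projections
  \<open>rplus S a\<close> and \<open>rplus S b\<close>, and both lie over
  \<open>\<theta> a\<close>; joint injectivity of \<open>rplus\<close> and \<open>\<theta>\<close>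
  identifies them.\<close>

lemma compatible_if_same_cover:
  assumes a: "a \<in> carrier S" and b: "b \<in> carrier S" and eq: "\<theta> a = \<theta> b"
  shows "rplus S b \<cdot> a = rplus S a \<cdot> b"
proof (rule plus_inject)
  show "rplus S (rplus S b \<cdot> a) = rplus S (rplus S a \<cdot> b)"
    using a b by (metis plus_mult plus_comm)
  show "\<theta> (rplus S b \<cdot> a) = \<theta> (rplus S a \<cdot> b)"
    using a b eq by (simp add: cover_projection_mult plus_in_projections)
qed (use a b in \<open>auto intro: mult_closed plus_closed\<close>)

lemma compatible_star_if_same_cover:
  assumes a: "a \<in> carrier S" and b: "b \<in> carrier S" and eq: "\<theta> a = \<theta> b"
  shows "a \<cdot> rstar S b = b \<cdot> rstar S a"
proof (rule star_inject)
  show "rstar S (a \<cdot> rstar S b) = rstar S (b \<cdot> rstar S a)"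
    using a b by (metis star_mult star_comm)
  show "\<theta> (a \<cdot> rstar S b) = \<theta> (b \<cdot> rstar S a)"
    using a b eq by (simp add: cover_mult cover_star star_closed cover_closed)
qed (use a b in \<open>auto intro: mult_closed star_closed\<close>)

lemma sigma_iff: "(a, b) \<in> sigma S \<longleftrightarrow> a \<in> carrier S \<and> b \<in> carrier S \<and> \<theta> a = \<theta> b"
proof
  assume "(a, b) \<in> sigma S"
  then show "a \<in> carrier S \<and> b \<in> carrier S \<and> \<theta> a = \<theta> b"
    unfolding sigma_def using cover_projection_mult by (auto, metis)
next
  assume *: "a \<in> carrier S \<and> b \<in> carrier S \<and> \<theta> a = \<theta> b"
  \<comment> \<open>Multiplying by this witness turns each of \<open>a\<close> and \<open>b\<close>
    into \<open>rplus S a \<cdot> b\<close>: the first by compatibility, the second by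
    \<open>plus_left\<close>.\<close>
  let ?e = "rplus S a \<cdot> rplus S b"
  have "?e \<cdot> a = rplus S a \<cdot> (rplus S b \<cdot> a)"
    using * by (simp add: assoc plus_closed)
  also have "\<dots> = rplus S a \<cdot> (rplus S a \<cdot> b)"
    using * compatible_if_same_cover by simp
  also have "\<dots> = rplus S a \<cdot> b"
    using * by (metis assoc plus_closed plus_idem)
  also have "\<dots> = ?e \<cdot> b"
    using * by (simp add: assoc plus_closed plus_left)
  finally show "(a, b) \<in> sigma S"
    unfolding sigma_def using * by (auto intro: plus_in_projections projection_mult)
qed

lemma proper: "proper S"
  unfolding proper_def R_rel_def L_rel_def
  using restriction_semigroup_axioms
  by (auto simp: sigma_iff Id_on_def dest: plus_inject star_inject)

lemma sigma_class: "a \<in> carrier S \<Longrightarrow> sigma S `` {a} = {b \<in> carrier S. \<theta> b = \<theta> a}"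
  by (auto simp: sigma_iff)

lemma sigma_classes: "carrier S // sigma S = (\<lambda>t. {b \<in> carrier S. \<theta> b = t}) ` carrier T"
  unfolding quotient_def cover_image[symmetric] by (auto simp: sigma_class)

text \<open>The classes are the fibres of \<open>\<theta>\<close>, so the isomorphism reads off the
  value of \<open>\<theta>\<close> at any chosen member. Each union in the quotient operations is a
  single fibre, because \<open>\<theta>\<close> respects the operations and no fibre is
  empty.\<close>

lemma sigma_quotient_isomorphic: "rsg_isomorphic (sigma_quotient S) (plain_rsg T)"
proof -
  let ?cls = "\<lambda>t. {b \<in> carrier S. \<theta> b = t}"
  define H where "H A = \<theta> (SOME a. a \<in> A)" for A
  have ex: "\<exists>a. a \<in> carrier S \<and> \<theta> a = t" if "t \<in> carrier T" for t
    using that cover_image by force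
  have H: "H (?cls t) = t" if "t \<in> carrier T" for t
    unfolding H_def using someI_ex[of "\<lambda>a. a \<in> ?cls t"] ex[OF that] by auto
  have inj: "inj_on H (carrier S // sigma S)"
    unfolding sigma_classes by (rule inj_onI) (auto simp: H)
  have im: "H ` (carrier S // sigma S) = carrier T"
    unfolding sigma_classes by (auto simp: H image_image)
  have mult: "(\<Union>a\<in>?cls t. \<Union>b\<in>?cls u. sigma S `` {a \<cdot> b}) = ?cls (t \<otimes>\<^bsub>T\<^esub> u)"
    if "t \<in> carrier T" "u \<in> carrier T" for t u
    using ex[OF that(1)] ex[OF that(2)] by (auto simp: sigma_class mult_closed cover_mult)
  have plus: "(\<Union>a\<in>?cls t. sigma S `` {rplus S a}) = ?cls \<one>\<^bsub>T\<^esub>" if "t \<in> carrier T" for t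
    using ex[OF that] by (auto simp: sigma_class plus_closed cover_plus)
  have star: "(\<Union>a\<in>?cls t. sigma S `` {rstar S a}) = ?cls \<one>\<^bsub>T\<^esub>" if "t \<in> carrier T" for t
    using ex[OF that] by (auto simp: sigma_class star_closed cover_star)
  have "H \<in> rsg_iso (sigma_quotient S) (plain_rsg T)"
    unfolding rsg_iso_def sigma_quotient_def plain_rsg_def
    using inj im by (auto simp: bij_betw_def sigma_classes mult plus star H)
  then show ?thesis unfolding rsg_isomorphic_def by blast
qed

end

section \<open>Greatest elements of \<sigma>-classes and T-properness\<close>

locale F_cover = proper_cover S T \<theta>
  for S :: "('a, 'b) rsg_scheme" (structure)
    and T :: "('t, 'c) monoid_scheme" and \<theta> :: "'a \<Rightarrow> 't" +
  fixes \<mu> :: "'t \<Rightarrow> 'a"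
  assumes greatest_closed: "t \<in> carrier T \<Longrightarrow> \<mu> t \<in> carrier S"
    and greatest_cover: "t \<in> carrier T \<Longrightarrow> \<theta> (\<mu> t) = t"
    and le_greatest: "x \<in> carrier S \<Longrightarrow> natural_le S x (\<mu> (\<theta> x))"
begin

lemma greatest_one_projection: "\<mu> \<one>\<^bsub>T\<^esub> \<in> projections S"
proof -
  let ?m = "\<mu> \<one>\<^bsub>T\<^esub>"
  have m: "?m \<in> carrier S" by (simp add: greatest_closed)
  \<comment> \<open>\<open>rplus S ?m\<close> and \<open>?m\<close> have the same
    \<open>rplus\<close> and both lie over the identity of \<open>T\<close>, so
    \<open>plus_inject\<close> makes them equal.\<close>
  then have "rplus S ?m = ?m"
    by (auto intro!: plus_inject[of "rplus S ?m" ?m] simp: plus_closed plus_plus cover_plus greatest_cover)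
  with m show ?thesis by (simp add: projections_iff)
qed

text \<open>A projection lies over the identity of \<open>T\<close>, hence is a multiple
  \<open>f \<cdot> m\<close> of the greatest element \<open>m\<close> there; as \<open>m\<close> is
  itself a projection, it is idempotent and is absorbed on the right.\<close>

lemma projection_mult_greatest_one:
  assumes e: "e \<in> projections S" shows "e \<cdot> \<mu> \<one>\<^bsub>T\<^esub> = e"
proof -
  have "\<theta> e = \<one>\<^bsub>T\<^esub>" using e by (metis cover_plus projections_iff)
  then obtain f where f: "f \<in> projections S" "e = f \<cdot> \<mu> \<one>\<^bsub>T\<^esub>"
    using e le_greatest[of e] by (auto simp: natural_le_def projections_iff)
  show ?thesis
    using f by (metis assoc greatest_one_projection projection_closed projection_idem)
qed

text \<open>Writing \<open>x\<close> as \<open>rplus S x \<cdot> x\<close> for the left law and as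
  \<open>x \<cdot> rstar S x\<close> for the right law reduces the claim to projections.\<close>

lemma identity_greatest: "is_identity S (\<mu> \<one>\<^bsub>T\<^esub>)"
proof -
  let ?m = "\<mu> \<one>\<^bsub>T\<^esub>"
  have m: "?m \<in> carrier S" by (simp add: greatest_closed)
  have "?m \<cdot> x = x" if x: "x \<in> carrier S" for x
  proof -
    have "?m \<cdot> x = ?m \<cdot> rplus S x \<cdot> x"
      using m x by (simp add: assoc plus_closed plus_left)
    also have "?m \<cdot> rplus S x = rplus S x"
      using x by (simp add: projection_comm[OF greatest_one_projection] plus_in_projections
          projection_mult_greatest_one)
    finally show ?thesis using x by (simp add: plus_left)
  qed
  moreover have "x \<cdot> ?m = x" if x: "x \<in> carrier S" for x
  proof -
    have "x \<cdot> ?m = x \<cdot> (rstar S x \<cdot> ?m)"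
      using m x by (simp add: assoc[symmetric] star_closed star_right)
    then show ?thesis
      using x by (simp add: projection_mult_greatest_one star_in_projections star_right)
  qed
  ultimately show ?thesis using m by (simp add: is_identity_def)
qed

lemma restriction_monoid: "restriction_monoid S"
  unfolding restriction_monoid_def using restriction_semigroup_axioms identity_greatest by (intro conjI exI)

lemma F_restriction: "F_restriction S"
proof -
  have "\<exists>m\<in>X. \<forall>a\<in>X. natural_le S a m" if X: "X \<in> carrier S // sigma S" for X
  proof -
    obtain t where t: "t \<in> carrier T" "X = {b \<in> carrier S. \<theta> b = t}"
      using X by (auto simp: sigma_classes)
    then have "\<mu> t \<in> X" "\<forall>a\<in>X. natural_le S a (\<mu> t)"
      using le_greatest by (auto simp: greatest_closed greatest_cover)
    then show ?thesis by blast
  qed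
  then show ?thesis
    unfolding F_restriction_def using restriction_monoid proper by blast
qed

lemma one_plain_reduct: "\<one>\<^bsub>plain_reduct S\<^esub> = \<mu> \<one>\<^bsub>T\<^esub>"
proof -
  have "(THE u. is_identity S u) = \<mu> \<one>\<^bsub>T\<^esub>"
    using identity_greatest by (rule the_equality) (rule identity_unique[OF _ identity_greatest])
  then show ?thesis by (simp add: plain_reduct_def)
qed

text \<open>Antisymmetry of the natural order. With \<open>m\<close> for the greatest element,
  \<open>e \<cdot> m = m\<close>, and since projections commute, \<open>x\<close> equals
  \<open>f \<cdot> m\<close>, then \<open>f \<cdot> (e \<cdot> m)\<close>,
  \<open>e \<cdot> (f \<cdot> m)\<close>, \<open>e \<cdot> x\<close> and finally
  \<open>m\<close>.\<close>

lemma greatest_if_above_greatest: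
  assumes e: "e \<in> projections S" and x: "x \<in> carrier S" and eq: "\<mu> (\<theta> x) = e \<cdot> x"
  shows "\<mu> (\<theta> x) = x"
proof -
  obtain f where f: "f \<in> projections S" "x = f \<cdot> \<mu> (\<theta> x)"
    using le_greatest[OF x] by (auto simp: natural_le_def)
  have m: "\<mu> (\<theta> x) \<in> carrier S" using x by (simp add: cover_closed greatest_closed)
  have em: "e \<cdot> \<mu> (\<theta> x) = \<mu> (\<theta> x)"
    using e x eq by (metis assoc projection_closed projection_idem)
  have "x = f \<cdot> (e \<cdot> \<mu> (\<theta> x))" using em f by simp
  also have "\<dots> = e \<cdot> (f \<cdot> \<mu> (\<theta> x))"
    using e f m by (metis assoc projection_closed projection_comm)
  finally show ?thesis using f eq by simp
qed

text \<open>Since \<open>S = P\<^sub>S T'\<close> meets every \<open>\<sigma>\<close>-class, a submonoid \<open>T'\<close> as in the definition of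
  \<open>T\<close>-proper can only consist of the greatest elements of the classes.\<close>

lemma T_proper_iff:
  "T_proper T S \<longleftrightarrow> (\<forall>t\<in>carrier T. \<forall>u\<in>carrier T. \<mu> t \<cdot> \<mu> u = \<mu> (t \<otimes>\<^bsub>T\<^esub> u))"
proof
  assume "T_proper T S"
  then obtain T' where sub: "submonoid T' (plain_reduct S)"
    and gen: "carrier S = {e \<cdot> t | e t. e \<in> projections S \<and> t \<in> T'}"
    and sep: "\<forall>a\<in>T'. \<forall>b\<in>T'. (a, b) \<in> sigma S \<longrightarrow> a = b"
    unfolding T_proper_def by blast
  have T': "T' \<subseteq> carrier S" and mult: "\<And>a b. \<lbrakk>a \<in> T'; b \<in> T'\<rbrakk> \<Longrightarrow> a \<cdot> b \<in> T'"
    using submonoid.subset[OF sub] submonoid.m_closed[OF sub] by (auto simp: plain_reduct_def)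
  \<comment> \<open>\<open>\<mu> t\<close> is a projection times some \<open>s\<close> in
    \<open>T'\<close>; this \<open>s\<close> lies over \<open>t\<close> and above
    \<open>\<mu> t\<close>, so it is \<open>\<mu> t\<close>.\<close>
  have greatest_in: "\<mu> t \<in> T'" if t: "t \<in> carrier T" for t
  proof -
    obtain e s where es: "e \<in> projections S" "s \<in> T'" "\<mu> t = e \<cdot> s"
      using greatest_closed[OF t] gen by blast
    then have s: "s \<in> carrier S" using T' by blast
    then have "\<theta> s = t" using es t by (metis cover_projection_mult greatest_cover)
    then show ?thesis using greatest_if_above_greatest es s by metis
  qed
  show "\<forall>t\<in>carrier T. \<forall>u\<in>carrier T. \<mu> t \<cdot> \<mu> u = \<mu> (t \<otimes>\<^bsub>T\<^esub> u)"
  proof (intro ballI)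
    fix t u assume tu: "t \<in> carrier T" "u \<in> carrier T"
    then have "\<mu> t \<cdot> \<mu> u \<in> T'" "\<mu> (t \<otimes>\<^bsub>T\<^esub> u) \<in> T'" by (auto intro: greatest_in mult)
    moreover have "(\<mu> t \<cdot> \<mu> u, \<mu> (t \<otimes>\<^bsub>T\<^esub> u)) \<in> sigma S"
      using tu by (simp add: sigma_iff mult_closed greatest_closed cover_mult greatest_cover)
    ultimately show "\<mu> t \<cdot> \<mu> u = \<mu> (t \<otimes>\<^bsub>T\<^esub> u)" using sep by blast
  qed
next
  assume hom: "\<forall>t\<in>carrier T. \<forall>u\<in>carrier T. \<mu> t \<cdot> \<mu> u = \<mu> (t \<otimes>\<^bsub>T\<^esub> u)"
  \<comment> \<open>Conversely the greatest elements themselves form the submonoid: multiplicativity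
    of \<open>\<mu>\<close> gives closure, \<open>\<theta>\<close> inverts \<open>\<mu>\<close>, and
    \<open>le_greatest\<close> writes every element as a projection times one of them.\<close>
  let ?T' = "\<mu> ` carrier T"
  have "submonoid ?T' (plain_reduct S)"
  proof
    show "\<one>\<^bsub>plain_reduct S\<^esub> \<in> ?T'" by (simp add: one_plain_reduct)
  qed (use hom in \<open>auto simp: plain_reduct_def greatest_closed\<close>)
  moreover have "\<theta> \<in> iso ((plain_reduct S)\<lparr>carrier := ?T'\<rparr>) T"
    unfolding iso_def hom_def bij_betw_def
    by (auto simp: inj_on_def greatest_cover plain_reduct_def cover_mult greatest_closed image_image)
  then have "(plain_reduct S)\<lparr>carrier := ?T'\<rparr> \<cong> T" unfolding is_iso_def by blast
  moreover have "carrier S = {e \<cdot> t | e t. e \<in> projections S \<and> t \<in> ?T'}"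
  proof
    show "carrier S \<subseteq> {e \<cdot> t | e t. e \<in> projections S \<and> t \<in> ?T'}"
    proof
      fix x assume "x \<in> carrier S"
      then show "x \<in> {e \<cdot> t | e t. e \<in> projections S \<and> t \<in> ?T'}"
        using le_greatest[of x] cover_closed[of x] unfolding natural_le_def by blast
    qed
  qed (auto simp: mult_closed projection_closed greatest_closed)
  moreover have "\<forall>a\<in>?T'. \<forall>b\<in>?T'. (a, b) \<in> sigma S \<longrightarrow> a = b"
    by (auto simp: sigma_iff greatest_cover)
  ultimately show "T_proper T S"
    unfolding T_proper_def using restriction_monoid by (intro conjI exI[of _ ?T'])
qed

end

section \<open>Transport along isomorphisms\<close>

lemma rsg_isomorphicI: "h \<in> rsg_iso S R \<Longrightarrow> rsg_isomorphic S R"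
  by (auto simp: rsg_isomorphic_def)

lemma rsg_iso_comp:
  assumes h: "h \<in> rsg_iso S R" and k: "k \<in> rsg_iso R Q"
  shows "k \<circ> h \<in> rsg_iso S Q"
proof -
  have "\<And>x. x \<in> carrier S \<Longrightarrow> h x \<in> carrier R"
    using h by (auto simp: rsg_iso_def bij_betw_def)
  then show ?thesis using h k by (auto simp: rsg_iso_def intro: bij_betw_trans)
qed

text \<open>\<open>rsg_iso\<close> constrains values on the carriers only, so closure of
  \<open>S\<close> is assumed separately: \<open>inv_into\<close> undoes \<open>h\<close> on the
  result of an operation once that result is known to lie in \<open>carrier S\<close>.\<close>

lemma rsg_iso_sym:
  assumes h: "h \<in> rsg_iso S R"
    and mult_closed: "\<And>x y. \<lbrakk>x \<in> carrier S; y \<in> carrier S\<rbrakk> \<Longrightarrow> x \<cdot>\<^bsub>S\<^esub> y \<in> carrier S"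
    and plus_closed: "\<And>x. x \<in> carrier S \<Longrightarrow> rplus S x \<in> carrier S"
    and star_closed: "\<And>x. x \<in> carrier S \<Longrightarrow> rstar S x \<in> carrier S"
  shows "inv_into (carrier S) h \<in> rsg_iso R S"
proof -
  have bij_h: "bij_betw h (carrier S) (carrier R)" using h by (simp add: rsg_iso_def)
  then have inj: "inj_on h (carrier S)" and im: "carrier R = h ` carrier S"
    by (auto simp: bij_betw_def)
  have bij: "bij_betw (inv_into (carrier S) h) (carrier R) (carrier S)"
    using bij_h by (rule bij_betw_inv_into)
  let ?g = "inv_into (carrier S) h"
  note inv = inv_into_f_f[OF inj]
  have "?g (h x \<cdot>\<^bsub>R\<^esub> h y) = x \<cdot>\<^bsub>S\<^esub> y" if "x \<in> carrier S" "y \<in> carrier S" for x y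
    using that h inv[of "x \<cdot>\<^bsub>S\<^esub> y"] by (simp add: rsg_iso_def mult_closed)
  moreover have "?g (rplus R (h x)) = rplus S x" "?g (rstar R (h x)) = rstar S x"
    if "x \<in> carrier S" for x
    using that h inv[of "rplus S x"] inv[of "rstar S x"]
    by (simp_all add: rsg_iso_def plus_closed star_closed)
  ultimately show ?thesis
    using bij unfolding rsg_iso_def by (auto simp: im inv)
qed

text \<open>Every result of an operation of \<open>R\<close> is the image under \<open>h\<close> of
  the corresponding result in \<open>S\<close>, so closure and the identities carry over
  together.\<close>

lemma restriction_semigroup_iso:
  assumes S: "restriction_semigroup S" and h: "h \<in> rsg_iso S R"
  shows "restriction_semigroup R"
proof -
  interpret restriction_semigroup S by (rule S)
  have im: "carrier R = h ` carrier S"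
    and mult: "\<And>x y. \<lbrakk>x \<in> carrier S; y \<in> carrier S\<rbrakk> \<Longrightarrow> h x \<cdot>\<^bsub>R\<^esub> h y = h (x \<cdot>\<^bsub>S\<^esub> y)"
    and plus: "\<And>x. x \<in> carrier S \<Longrightarrow> rplus R (h x) = h (rplus S x)"
    and star: "\<And>x. x \<in> carrier S \<Longrightarrow> rstar R (h x) = h (rstar S x)"
    using h by (auto simp: rsg_iso_def bij_betw_def)
  note closed = mult_closed plus_closed star_closed
  show ?thesis
  proof
    fix x y z assume "x \<in> carrier R" "y \<in> carrier R" "z \<in> carrier R"
    then show "x \<cdot>\<^bsub>R\<^esub> y \<cdot>\<^bsub>R\<^esub> z = x \<cdot>\<^bsub>R\<^esub> (y \<cdot>\<^bsub>R\<^esub> z)"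
      by (auto simp: im mult closed assoc)
  next
    fix x y assume "x \<in> carrier R" "y \<in> carrier R"
    then obtain a b where ab: "a \<in> carrier S" "b \<in> carrier S" "x = h a" "y = h b"
      by (auto simp: im)
    show "rplus R (rplus R x \<cdot>\<^bsub>R\<^esub> y) = rplus R x \<cdot>\<^bsub>R\<^esub> rplus R y"
      using ab by (simp add: mult plus closed plus_mult)
    show "rplus R x \<cdot>\<^bsub>R\<^esub> rplus R y = rplus R y \<cdot>\<^bsub>R\<^esub> rplus R x"
      using ab plus_comm[of a b] by (simp add: mult plus closed)
    show "x \<cdot>\<^bsub>R\<^esub> rplus R y = rplus R (x \<cdot>\<^bsub>R\<^esub> y) \<cdot>\<^bsub>R\<^esub> x"
      using ab by (simp add: mult plus closed plus_ample)
    show "rstar R (y \<cdot>\<^bsub>R\<^esub> rstar R x) = rstar R y \<cdot>\<^bsub>R\<^esub> rstar R x"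
      using ab by (simp add: mult star closed star_mult)
    show "rstar R y \<cdot>\<^bsub>R\<^esub> rstar R x = rstar R x \<cdot>\<^bsub>R\<^esub> rstar R y"
      using ab star_comm[of a b] by (simp add: mult star closed)
    show "rstar R y \<cdot>\<^bsub>R\<^esub> x = x \<cdot>\<^bsub>R\<^esub> rstar R (y \<cdot>\<^bsub>R\<^esub> x)"
      using ab by (simp add: mult star closed star_ample)
  qed (auto simp: im mult plus star closed plus_left star_right star_plus plus_star nonempty)
qed

lemma proper_cover_iso:
  assumes S: "proper_cover S T \<theta>" and h: "h \<in> rsg_iso S R"
  shows "proper_cover R T (\<theta> \<circ> inv_into (carrier S) h)"
proof -
  interpret S: proper_cover S T \<theta> by (rule S)
  interpret R: restriction_semigroup R
    using restriction_semigroup_iso S.restriction_semigroup_axioms h by blast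
  let ?g = "inv_into (carrier S) h"
  have g: "?g \<in> rsg_iso R S"
    using rsg_iso_sym[OF h] S.mult_closed S.plus_closed S.star_closed by blast
  then have im: "?g ` carrier R = carrier S" and inj: "inj_on ?g (carrier R)"
    by (auto simp: rsg_iso_def bij_betw_def)
  have closed: "?g x \<in> carrier S" if "x \<in> carrier R" for x using im that by blast
  have plus: "rplus S (?g x) = ?g (rplus R x)" and star: "rstar S (?g x) = ?g (rstar R x)"
    if "x \<in> carrier R" for x using g that by (auto simp: rsg_iso_def)
  show ?thesis
  proof
    show "(\<theta> \<circ> ?g) ` carrier R = carrier T"
      by (metis S.cover_image im image_comp)
  next
    fix x y assume "x \<in> carrier R" "y \<in> carrier R" "rplus R x = rplus R y"
      "(\<theta> \<circ> ?g) x = (\<theta> \<circ> ?g) y"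
    moreover from this have "rplus S (?g x) = rplus S (?g y)"
      by (simp add: plus)
    ultimately have "?g x = ?g y"
      by (simp add: S.plus_inject closed)
    then show "x = y" using inj \<open>x \<in> carrier R\<close> \<open>y \<in> carrier R\<close> by (auto dest: inj_onD)
  next
    fix x y assume "x \<in> carrier R" "y \<in> carrier R" "rstar R x = rstar R y"
      "(\<theta> \<circ> ?g) x = (\<theta> \<circ> ?g) y"
    moreover from this have "rstar S (?g x) = rstar S (?g y)"
      by (simp add: star)
    ultimately have "?g x = ?g y"
      by (simp add: S.star_inject closed)
    then show "x = y" using inj \<open>x \<in> carrier R\<close> \<open>y \<in> carrier R\<close> by (auto dest: inj_onD)
  qed (use g closed in \<open>auto simp: rsg_iso_def S.cover_mult S.cover_plus S.cover_star\<close>)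
qed

text \<open>An isomorphism commutes with \<open>rplus\<close> and so preserves projections; it
  therefore carries the factorisation of an element through the greatest element of its class over
  to \<open>R\<close>.\<close>

lemma F_cover_iso:
  assumes S: "F_cover S T \<theta> \<mu>" and h: "h \<in> rsg_iso S R"
  shows "F_cover R T (\<theta> \<circ> inv_into (carrier S) h) (h \<circ> \<mu>)"
proof -
  interpret S: F_cover S T \<theta> \<mu> by (rule S)
  interpret R: proper_cover R T "\<theta> \<circ> inv_into (carrier S) h"
    using proper_cover_iso S.proper_cover_axioms h by blast
  have inj: "inj_on h (carrier S)" and im: "carrier R = h ` carrier S"
    using h by (auto simp: rsg_iso_def bij_betw_def)
  show ?thesis
  proof
    fix x assume "x \<in> carrier R"
    then obtain a where a: "a \<in> carrier S" "x = h a" by (auto simp: im)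
    obtain e where e: "e \<in> projections S" "a = e \<cdot>\<^bsub>S\<^esub> \<mu> (\<theta> a)"
      using S.le_greatest[OF a(1)] by (auto simp: natural_le_def)
    have "h e \<in> projections R"
      using e h by (auto simp: projections_def im rsg_iso_def)
    moreover have "h a = h e \<cdot>\<^bsub>R\<^esub> h (\<mu> (\<theta> a))"
      using h e(1) S.projection_closed S.greatest_closed S.cover_closed[OF a(1)]
      by (subst e(2)) (simp add: rsg_iso_def)
    moreover have "inv_into (carrier S) h x = a" using a inj by simp
    ultimately show "natural_le R x ((h \<circ> \<mu>) ((\<theta> \<circ> inv_into (carrier S) h) x))"
      using a(2) by (auto simp: natural_le_def)
  next
    fix t assume "t \<in> carrier T"
    then have t: "\<mu> t \<in> carrier S" "\<theta> (\<mu> t) = t"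
      by (simp_all add: S.greatest_closed S.greatest_cover)
    then show "(h \<circ> \<mu>) t \<in> carrier R" by (simp add: im)
    show "(\<theta> \<circ> inv_into (carrier S) h) ((h \<circ> \<mu>) t) = t"
      using t by (simp add: inv_into_f_f[OF inj])
  qed
qed

section \<open>Partial bijections below a subaction\<close>

lemma map_eqI: "(\<And>x y. \<beta> x = Some y \<longleftrightarrow> \<gamma> x = Some y) \<Longrightarrow> \<beta> = \<gamma>"
  by (rule ext) (metis not_None_eq)

lemma map_le_iff: "\<beta> \<subseteq>\<^sub>m \<gamma> \<longleftrightarrow> (\<forall>x y. \<beta> x = Some y \<longrightarrow> \<gamma> x = Some y)"
  by (auto simp: map_le_def dom_def)

lemma inj_on_dom_iff:
  "inj_on \<beta> (dom \<beta>) \<longleftrightarrow> (\<forall>x x' y. \<beta> x = Some y \<longrightarrow> \<beta> x' = Some y \<longrightarrow> x = x')"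
  by (auto simp: inj_on_def dom_def)

lemma pcomp_Some: "pcomp \<beta> \<gamma> x = Some z \<longleftrightarrow> (\<exists>y. \<beta> x = Some y \<and> \<gamma> y = Some z)"
  by (auto simp: pcomp_def map_comp_def split: option.splits)

lemma restrict_Some: "(\<beta> |` D) x = Some y \<longleftrightarrow> x \<in> D \<and> \<beta> x = Some y"
  by (auto simp: restrict_map_def)

lemma in_dom_iff: "x \<in> dom \<beta> \<longleftrightarrow> (\<exists>y. \<beta> x = Some y)"
  by auto

lemma in_ran_iff: "y \<in> ran \<beta> \<longleftrightarrow> (\<exists>x. \<beta> x = Some y)"
  by (auto simp: ran_def)

text \<open>Together with \<open>map_eqI\<close> and \<open>map_le_iff\<close>, these rules turn
  equations and inclusions of partial maps into first-order statements about the relation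
  \<open>\<beta> x = Some y\<close>.\<close>

lemmas partial_map_simps = pcomp_Some restrict_Some in_dom_iff in_ran_iff

lemma map_le_same_dom: "\<lbrakk>\<beta> \<subseteq>\<^sub>m \<delta>; \<gamma> \<subseteq>\<^sub>m \<delta>; dom \<beta> = dom \<gamma>\<rbrakk> \<Longrightarrow> \<beta> = \<gamma>"
  by (metis map_le_antisym map_le_def)

text \<open>A common value has a single preimage under the injective map \<open>\<delta>\<close>, so
  both restrictions attain it at the same point. This and \<open>map_le_same_dom\<close> later
  supply the two joint injectivity conditions of a cover.\<close>

lemma map_le_same_ran:
  assumes "inj_on \<delta> (dom \<delta>)" "\<beta> \<subseteq>\<^sub>m \<delta>" "\<gamma> \<subseteq>\<^sub>m \<delta>" "ran \<beta> = ran \<gamma>"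
  shows "\<beta> = \<gamma>"
proof (rule map_eqI)
  fix x y show "\<beta> x = Some y \<longleftrightarrow> \<gamma> x = Some y"
    using assms unfolding map_le_iff inj_on_dom_iff set_eq_iff in_ran_iff by metis
qed

text \<open>The converse relation as a partial map, undefined off the range; the description picks
  out a unique preimage when \<open>\<beta>\<close> is injective.\<close>

definition map_inverse :: "('y \<rightharpoonup> 'y) \<Rightarrow> ('y \<rightharpoonup> 'y)" where
  "map_inverse \<beta> y = (if y \<in> ran \<beta> then Some (THE x. \<beta> x = Some y) else None)"

lemma map_inverse_Some:
  assumes "inj_on \<beta> (dom \<beta>)" shows "map_inverse \<beta> y = Some x \<longleftrightarrow> \<beta> x = Some y"
proof -
  have "(THE x. \<beta> x = Some y) = x'" if "\<beta> x' = Some y" for x'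
    using that assms by (auto simp: inj_on_dom_iff)
  then show ?thesis by (auto simp: map_inverse_def in_ran_iff)
qed

lemma inj_map_inverse:
  assumes "inj_on \<beta> (dom \<beta>)" shows "inj_on (map_inverse \<beta>) (dom (map_inverse \<beta>))"
  unfolding inj_on_dom_iff map_inverse_Some[OF assms] by auto

lemma dom_map_inverse: "inj_on \<beta> (dom \<beta>) \<Longrightarrow> dom (map_inverse \<beta>) = ran \<beta>"
  by (simp add: set_eq_iff partial_map_simps map_inverse_Some)

lemma ran_map_inverse: "inj_on \<beta> (dom \<beta>) \<Longrightarrow> ran (map_inverse \<beta>) = dom \<beta>"
  by (simp add: set_eq_iff partial_map_simps map_inverse_Some)

lemma pcomp_map_inverse: "inj_on \<beta> (dom \<beta>) \<Longrightarrow> pcomp \<beta> (map_inverse \<beta>) = Some |` dom \<beta>"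
  by (rule map_eqI) (auto simp: partial_map_simps map_inverse_Some inj_on_dom_iff)

lemma map_inverse_pcomp: "inj_on \<beta> (dom \<beta>) \<Longrightarrow> pcomp (map_inverse \<beta>) \<beta> = Some |` ran \<beta>"
  by (rule map_eqI) (auto simp: partial_map_simps map_inverse_Some)

text \<open>If \<epsilon> is injective and composing \<epsilon>, \<delta>, \<epsilon> gives
  \<epsilon>, then \<delta> must send each value of \<epsilon> back to its argument. The two
  equations together make the graphs of \<open>\<beta>\<close> and \<open>\<gamma>\<close> converse
  to each other.\<close>

lemma map_inverse_unique:
  assumes \<beta>: "inj_on \<beta> (dom \<beta>)" and \<gamma>: "inj_on \<gamma> (dom \<gamma>)"
    and eq1: "pcomp (pcomp \<beta> \<gamma>) \<beta> = \<beta>" and eq2: "pcomp (pcomp \<gamma> \<beta>) \<gamma> = \<gamma>"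
  shows "\<gamma> = map_inverse \<beta>"
proof -
  have inv: "\<delta> y = Some x"
    if "inj_on \<epsilon> (dom \<epsilon>)" "pcomp (pcomp \<epsilon> \<delta>) \<epsilon> = \<epsilon>" "\<epsilon> x = Some y"
    for \<delta> \<epsilon> :: "'a \<rightharpoonup> 'a" and x y
  proof -
    have "pcomp (pcomp \<epsilon> \<delta>) \<epsilon> x = Some y" using that by simp
    then show ?thesis using that(1,3) by (auto simp: partial_map_simps inj_on_dom_iff)
  qed
  show ?thesis
    by (rule map_eqI) (metis inv[OF \<beta> eq1] inv[OF \<gamma> eq2] map_inverse_Some[OF \<beta>])
qed

text \<open>Isolates what \<open>TI_set\<close> and \<open>TP_set\<close> have in common, so that
  inverses, projections and the natural order are computed once for both.\<close>

locale partial_bijections =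
  fixes A :: "('y \<rightharpoonup> 'y) set"
  assumes inj: "\<beta> \<in> A \<Longrightarrow> inj_on \<beta> (dom \<beta>)"
    and pcomp_closed: "\<lbrakk>\<beta> \<in> A; \<gamma> \<in> A\<rbrakk> \<Longrightarrow> pcomp \<beta> \<gamma> \<in> A"
    and inverse_closed: "\<beta> \<in> A \<Longrightarrow> map_inverse \<beta> \<in> A"
begin

lemma dom_closed: "\<beta> \<in> A \<Longrightarrow> Some |` dom \<beta> \<in> A"
  by (metis inj inverse_closed pcomp_closed pcomp_map_inverse)

lemma ran_closed: "\<beta> \<in> A \<Longrightarrow> Some |` ran \<beta> \<in> A"
  by (metis inj inverse_closed pcomp_closed map_inverse_pcomp)

text \<open>\<open>semigroup_inverse\<close> is a definite description within \<open>A\<close>; its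
  uniqueness comes from injectivity of the members of \<open>A\<close>.\<close>

lemma semigroup_inverse_eq:
  assumes "\<beta> \<in> A" shows "semigroup_inverse A pcomp \<beta> = map_inverse \<beta>"
  unfolding semigroup_inverse_def
proof (rule the_equality)
  note \<beta> = inj[OF assms]
  have "pcomp (pcomp \<beta> (map_inverse \<beta>)) \<beta> = \<beta>"
    unfolding pcomp_map_inverse[OF \<beta>] by (rule map_eqI) (auto simp: partial_map_simps)
  moreover have "pcomp (pcomp (map_inverse \<beta>) \<beta>) (map_inverse \<beta>) = map_inverse \<beta>"
    unfolding map_inverse_pcomp[OF \<beta>]
    by (rule map_eqI) (auto simp: partial_map_simps map_inverse_Some[OF \<beta>])
  ultimately show "map_inverse \<beta> \<in> A \<and> pcomp (pcomp \<beta> (map_inverse \<beta>)) \<beta> = \<beta> \<and>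
      pcomp (pcomp (map_inverse \<beta>) \<beta>) (map_inverse \<beta>) = map_inverse \<beta>"
    using inverse_closed[OF assms] by blast
qed (use assms inj map_inverse_unique in blast)

lemma rplus_inverse_rsg: "\<beta> \<in> A \<Longrightarrow> rplus (inverse_rsg A pcomp) \<beta> = Some |` dom \<beta>"
  by (simp add: inverse_rsg_def semigroup_inverse_eq pcomp_map_inverse inj)

lemma rstar_inverse_rsg: "\<beta> \<in> A \<Longrightarrow> rstar (inverse_rsg A pcomp) \<beta> = Some |` ran \<beta>"
  by (simp add: inverse_rsg_def semigroup_inverse_eq map_inverse_pcomp inj)

text \<open>Multiplying on the left by a projection restricts the domain of \<open>\<gamma>\<close>.
  Conversely a restriction \<open>\<beta>\<close> is \<open>\<gamma>\<close> preceded by the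
  identity on \<open>dom \<beta>\<close>, a projection because \<open>\<beta> \<in> A\<close>.
  Membership in \<open>A\<close> is where the orders of \<open>TI_rsg\<close> and
  \<open>TP_rsg\<close> differ.\<close>

lemma natural_le_inverse_rsg:
  assumes \<gamma>: "\<gamma> \<in> A"
  shows "natural_le (inverse_rsg A pcomp) \<beta> \<gamma> \<longleftrightarrow> \<beta> \<in> A \<and> \<beta> \<subseteq>\<^sub>m \<gamma>"
proof -
  have "projections (inverse_rsg A pcomp) = rplus (inverse_rsg A pcomp) ` A"
    by (simp add: projections_def inverse_rsg_def)
  then have "projections (inverse_rsg A pcomp) = (\<lambda>\<delta>. Some |` dom \<delta>) ` A"
    by (simp add: rplus_inverse_rsg)
  then have eq: "natural_le (inverse_rsg A pcomp) \<beta> \<gamma> \<longleftrightarrow>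
      (\<exists>\<delta>\<in>A. \<beta> = pcomp (Some |` dom \<delta>) \<gamma>)"
    by (auto simp: natural_le_def) (auto simp: inverse_rsg_def)
  show ?thesis
  proof
    assume "natural_le (inverse_rsg A pcomp) \<beta> \<gamma>"
    then show "\<beta> \<in> A \<and> \<beta> \<subseteq>\<^sub>m \<gamma>"
      using \<gamma> dom_closed pcomp_closed unfolding eq by (auto simp: map_le_iff partial_map_simps)
  next
    assume "\<beta> \<in> A \<and> \<beta> \<subseteq>\<^sub>m \<gamma>"
    moreover from this have "\<beta> = pcomp (Some |` dom \<beta>) \<gamma>"
      by (intro map_eqI) (auto simp: map_le_iff partial_map_simps)
    ultimately show "natural_le (inverse_rsg A pcomp) \<beta> \<gamma>" unfolding eq by blast
  qed
qed

end

section \<open>Pairs of a partial bijection and a monoid element acting above it\<close>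

definition restriction_rsg ::
  "('y \<rightharpoonup> 'y) set \<Rightarrow> ('t, 'c) monoid_scheme \<Rightarrow> ('t \<Rightarrow> ('y \<rightharpoonup> 'y)) \<Rightarrow> (('y \<rightharpoonup> 'y) \<times> 't) rsg" where
  "restriction_rsg A T \<alpha> = \<lparr> carrier = {(\<beta>, t). \<beta> \<in> A \<and> t \<in> carrier T \<and> \<beta> \<subseteq>\<^sub>m \<alpha> t},
     rmult = (\<lambda>(\<beta>, t) (\<gamma>, u). (pcomp \<beta> \<gamma>, t \<otimes>\<^bsub>T\<^esub> u)),
     rplus = (\<lambda>(\<beta>, t). (Some |` dom \<beta>, \<one>\<^bsub>T\<^esub>)),
     rstar = (\<lambda>(\<beta>, t). (Some |` ran \<beta>, \<one>\<^bsub>T\<^esub>)) \<rparr>"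

text \<open>The maps \<open>\<alpha> t\<close> are not placed in \<open>A\<close>, since for
  \<open>A = TP_set Y\<close> a subaction by arbitrary ideals may leave that set. Instead some
  member of \<open>A\<close> lies below each \<open>\<alpha> t\<close>, which makes the projection
  to \<open>T\<close> surjective.\<close>

locale partial_subaction = partial_bijections A + T: monoid T
  for A :: "('y \<rightharpoonup> 'y) set" and T :: "('t, 'c) monoid_scheme" +
  fixes \<alpha> :: "'t \<Rightarrow> ('y \<rightharpoonup> 'y)"
  assumes action_inj: "t \<in> carrier T \<Longrightarrow> inj_on (\<alpha> t) (dom (\<alpha> t))"
    and action_one: "\<beta> \<in> A \<Longrightarrow> Some |` dom \<beta> \<subseteq>\<^sub>m \<alpha> \<one>\<^bsub>T\<^esub>"
    and action_mult: "\<lbrakk>t \<in> carrier T; u \<in> carrier T\<rbrakk> \<Longrightarrow> pcomp (\<alpha> t) (\<alpha> u) \<subseteq>\<^sub>m \<alpha> (t \<otimes>\<^bsub>T\<^esub> u)"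
    and action_nonempty: "t \<in> carrier T \<Longrightarrow> \<exists>\<beta>\<in>A. \<beta> \<subseteq>\<^sub>m \<alpha> t"
begin

lemma action_one_ran: "\<beta> \<in> A \<Longrightarrow> Some |` ran \<beta> \<subseteq>\<^sub>m \<alpha> \<one>\<^bsub>T\<^esub>"
  by (metis action_one dom_map_inverse inj inverse_closed)

lemma pcomp_le_action:
  assumes "t \<in> carrier T" "u \<in> carrier T" "\<beta> \<subseteq>\<^sub>m \<alpha> t" "\<gamma> \<subseteq>\<^sub>m \<alpha> u"
  shows "pcomp \<beta> \<gamma> \<subseteq>\<^sub>m \<alpha> (t \<otimes>\<^bsub>T\<^esub> u)"
  using action_mult[OF assms(1,2)] assms(3,4) by (fastforce simp: map_le_iff partial_map_simps)

lemma restriction_semigroup: "restriction_semigroup (restriction_rsg A T \<alpha>)" (is "restriction_semigroup ?X")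
proof
  show "carrier ?X \<noteq> {}"
    using action_nonempty[of "\<one>\<^bsub>T\<^esub>"] by (auto simp: restriction_rsg_def)
next
  fix x assume "x \<in> carrier ?X"
  then obtain \<beta> t where x: "x = (\<beta>, t)" and "\<beta> \<in> A" "t \<in> carrier T" "\<beta> \<subseteq>\<^sub>m \<alpha> t"
    by (auto simp: restriction_rsg_def)
  then show "rplus ?X x \<in> carrier ?X"
    "rstar ?X x \<in> carrier ?X"
    by (auto simp: restriction_rsg_def dom_closed ran_closed action_one action_one_ran)
  show "rplus ?X x \<cdot>\<^bsub>?X\<^esub> x = x"
    "x \<cdot>\<^bsub>?X\<^esub> rstar ?X x = x"
    "rstar ?X (rplus ?X x) = rplus ?X x"
    "rplus ?X (rstar ?X x) = rstar ?X x"
    using x \<open>t \<in> carrier T\<close>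
    by (auto simp: restriction_rsg_def intro!: map_eqI) (auto simp: partial_map_simps)
next
  fix x y assume "x \<in> carrier ?X" "y \<in> carrier ?X"
  then obtain \<beta> t \<gamma> u where xy: "x = (\<beta>, t)" "y = (\<gamma>, u)" and A: "\<beta> \<in> A" "\<gamma> \<in> A"
    and tu: "t \<in> carrier T" "u \<in> carrier T" and le: "\<beta> \<subseteq>\<^sub>m \<alpha> t" "\<gamma> \<subseteq>\<^sub>m \<alpha> u"
    by (auto simp: restriction_rsg_def)
  show "x \<cdot>\<^bsub>?X\<^esub> y \<in> carrier ?X"
    using xy A tu le by (auto simp: restriction_rsg_def pcomp_closed pcomp_le_action)
  have inj: "\<beta> x = Some z \<Longrightarrow> \<beta> x' = Some z \<Longrightarrow> x = x'"
    "\<gamma> x = Some z \<Longrightarrow> \<gamma> x' = Some z \<Longrightarrow> x = x'" for x x' z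
    using A inj by (auto simp: inj_on_dom_iff)
  have "pcomp \<beta> (Some |` dom \<gamma>) = pcomp (Some |` dom (pcomp \<beta> \<gamma>)) \<beta>"
    by (rule map_eqI) (auto simp: partial_map_simps)
  then show "x \<cdot>\<^bsub>?X\<^esub> rplus ?X y =
      rplus ?X (x \<cdot>\<^bsub>?X\<^esub> y) \<cdot>\<^bsub>?X\<^esub> x"
    using xy tu by (simp add: restriction_rsg_def)
  \<comment> \<open>This rests on injectivity of \<open>\<beta>\<close>: a value in
    \<open>ran (pcomp \<gamma> \<beta>)\<close> has a preimage under \<open>\<beta>\<close> lying in
    \<open>ran \<gamma>\<close>, and that preimage can only be the argument at hand.\<close>
  have "pcomp (Some |` ran \<gamma>) \<beta> = pcomp \<beta> (Some |` ran (pcomp \<gamma> \<beta>))"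
    by (rule map_eqI) (auto simp: partial_map_simps dest: inj)
  then show "rstar ?X y \<cdot>\<^bsub>?X\<^esub> x =
      x \<cdot>\<^bsub>?X\<^esub> rstar ?X (y \<cdot>\<^bsub>?X\<^esub> x)"
    using xy tu by (simp add: restriction_rsg_def)
  have "Some |` dom (pcomp (Some |` dom \<beta>) \<gamma>) = pcomp (Some |` dom \<beta>) (Some |` dom \<gamma>)"
    by (rule map_eqI) (auto simp: partial_map_simps)
  then show "rplus ?X (rplus ?X x \<cdot>\<^bsub>?X\<^esub> y) =
      rplus ?X x \<cdot>\<^bsub>?X\<^esub> rplus ?X y"
    using xy by (simp add: restriction_rsg_def)
  have "Some |` ran (pcomp \<gamma> (Some |` ran \<beta>)) = pcomp (Some |` ran \<gamma>) (Some |` ran \<beta>)"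
    by (rule map_eqI) (auto simp: partial_map_simps)
  then show "rstar ?X (y \<cdot>\<^bsub>?X\<^esub> rstar ?X x) =
      rstar ?X y \<cdot>\<^bsub>?X\<^esub> rstar ?X x"
    using xy by (simp add: restriction_rsg_def)
  show "rplus ?X x \<cdot>\<^bsub>?X\<^esub> rplus ?X y =
      rplus ?X y \<cdot>\<^bsub>?X\<^esub> rplus ?X x"
    "rstar ?X y \<cdot>\<^bsub>?X\<^esub> rstar ?X x =
      rstar ?X x \<cdot>\<^bsub>?X\<^esub> rstar ?X y"
    using xy by (auto simp: restriction_rsg_def intro!: map_eqI) (auto simp: partial_map_simps)
next
  fix x y z
  assume "x \<in> carrier ?X" "y \<in> carrier ?X"
    "z \<in> carrier ?X"
  then show "x \<cdot>\<^bsub>?X\<^esub> y \<cdot>\<^bsub>?X\<^esub> z =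
      x \<cdot>\<^bsub>?X\<^esub> (y \<cdot>\<^bsub>?X\<^esub> z)"
    by (auto simp: restriction_rsg_def T.m_assoc intro!: map_eqI) (auto simp: partial_map_simps)
qed

text \<open>Over a fixed \<open>t\<close> all maps are restrictions of \<open>\<alpha> t\<close>;
  \<open>rplus\<close> reveals the domain and \<open>rstar\<close> the range, and either determines
  the map.\<close>

lemma proper_cover: "proper_cover (restriction_rsg A T \<alpha>) T snd"
proof (intro proper_cover.intro restriction_semigroup T.monoid_axioms proper_cover_axioms.intro)
  show "snd ` carrier (restriction_rsg A T \<alpha>) = carrier T"
    using action_nonempty by (force simp: restriction_rsg_def)
next
  fix x y assume "x \<in> carrier (restriction_rsg A T \<alpha>)" "y \<in> carrier (restriction_rsg A T \<alpha>)"
    and eq: "rplus (restriction_rsg A T \<alpha>) x = rplus (restriction_rsg A T \<alpha>) y" "snd x = snd y"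
  then obtain \<beta> \<gamma> t where *: "x = (\<beta>, t)" "y = (\<gamma>, t)" "\<beta> \<subseteq>\<^sub>m \<alpha> t" "\<gamma> \<subseteq>\<^sub>m \<alpha> t"
    by (auto simp: restriction_rsg_def)
  then have "Some |` dom \<beta> = Some |` dom \<gamma>" using eq by (simp add: restriction_rsg_def)
  then have "dom (Some |` dom \<beta>) = dom (Some |` dom \<gamma>)" by simp
  then have "dom \<beta> = dom \<gamma>" by (simp only: dom_restrict dom_const) simp
  then show "x = y" using * map_le_same_dom by blast
next
  fix x y assume "x \<in> carrier (restriction_rsg A T \<alpha>)" "y \<in> carrier (restriction_rsg A T \<alpha>)"
    and eq: "rstar (restriction_rsg A T \<alpha>) x = rstar (restriction_rsg A T \<alpha>) y" "snd x = snd y"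
  then obtain \<beta> \<gamma> t where *: "x = (\<beta>, t)" "y = (\<gamma>, t)" "\<beta> \<subseteq>\<^sub>m \<alpha> t" "\<gamma> \<subseteq>\<^sub>m \<alpha> t" "t \<in> carrier T"
    by (auto simp: restriction_rsg_def)
  then have "Some |` ran \<beta> = Some |` ran \<gamma>" using eq by (simp add: restriction_rsg_def)
  then have "dom (Some |` ran \<beta>) = dom (Some |` ran \<gamma>)" by simp
  then have "ran \<beta> = ran \<gamma>" by (simp only: dom_restrict dom_const) simp
  then show "x = y" using * map_le_same_ran action_inj by blast
qed (auto simp: restriction_rsg_def)

text \<open>Every map over \<open>t\<close> is a restriction of the full map
  \<open>\<alpha> t\<close>, and the projection exhibiting this is its own
  \<open>rplus\<close>.\<close>

lemma F_cover:
  assumes A: "\<And>t. t \<in> carrier T \<Longrightarrow> \<alpha> t \<in> A"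
  shows "F_cover (restriction_rsg A T \<alpha>) T snd (\<lambda>t. (\<alpha> t, t))"
proof (intro F_cover.intro proper_cover F_cover_axioms.intro)
  fix x assume x: "x \<in> carrier (restriction_rsg A T \<alpha>)"
  then obtain \<beta> t where *: "x = (\<beta>, t)" "\<beta> \<in> A" "t \<in> carrier T" "\<beta> \<subseteq>\<^sub>m \<alpha> t"
    by (auto simp: restriction_rsg_def)
  then have "\<beta> = pcomp (Some |` dom \<beta>) (\<alpha> t)"
    by (intro map_eqI) (auto simp: map_le_iff partial_map_simps)
  then have "x = rplus (restriction_rsg A T \<alpha>) x \<cdot>\<^bsub>restriction_rsg A T \<alpha>\<^esub> (\<alpha> (snd x), snd x)"
    using * by (simp add: restriction_rsg_def)
  then show "natural_le (restriction_rsg A T \<alpha>) x (\<alpha> (snd x), snd x)"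
    unfolding natural_le_def projections_def using x by blast
qed (use A in \<open>auto simp: restriction_rsg_def\<close>)

text \<open>Stated for an isomorphic copy \<open>R\<close> so as to serve both \<open>W_rsg\<close>,
  with \<open>A = TP_set Y\<close>, and its monoid of permissible subsets, with
  \<open>A = TI_set Y\<close>. The condition of \<open>T_proper_iff\<close> is pulled back through
  \<open>h\<close>, which is injective on the carrier.\<close>

lemma T_proper_iso_iff:
  assumes A: "\<And>t. t \<in> carrier T \<Longrightarrow> \<alpha> t \<in> A" and h: "h \<in> rsg_iso (restriction_rsg A T \<alpha>) R"
  shows "T_proper T R \<longleftrightarrow> (\<forall>t\<in>carrier T. \<forall>u\<in>carrier T. pcomp (\<alpha> t) (\<alpha> u) = \<alpha> (t \<otimes>\<^bsub>T\<^esub> u))"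
proof -
  let ?X = "restriction_rsg A T \<alpha>"
  interpret X: F_cover ?X T snd "\<lambda>t. (\<alpha> t, t)" using F_cover A by blast
  interpret R: F_cover R T "snd \<circ> inv_into (carrier ?X) h" "h \<circ> (\<lambda>t. (\<alpha> t, t))"
    using F_cover_iso X.F_cover_axioms h by blast
  have "h (\<alpha> t, t) \<cdot>\<^bsub>R\<^esub> h (\<alpha> u, u) = h (\<alpha> (t \<otimes>\<^bsub>T\<^esub> u), t \<otimes>\<^bsub>T\<^esub> u)
      \<longleftrightarrow> pcomp (\<alpha> t) (\<alpha> u) = \<alpha> (t \<otimes>\<^bsub>T\<^esub> u)"
    if "t \<in> carrier T" "u \<in> carrier T" for t u
  proof -
    have cl: "(\<alpha> t, t) \<in> carrier ?X" "(\<alpha> u, u) \<in> carrier ?X"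
      "(\<alpha> (t \<otimes>\<^bsub>T\<^esub> u), t \<otimes>\<^bsub>T\<^esub> u) \<in> carrier ?X"
      using that X.greatest_closed by auto
    then have "h (\<alpha> t, t) \<cdot>\<^bsub>R\<^esub> h (\<alpha> u, u) = h ((\<alpha> t, t) \<cdot>\<^bsub>?X\<^esub> (\<alpha> u, u))"
      using h by (simp add: rsg_iso_def)
    moreover have "inj_on h (carrier ?X)" using h by (simp add: rsg_iso_def bij_betw_def)
    ultimately show ?thesis
      using inj_on_eq_iff[OF _ X.mult_closed[OF cl(1,2)] cl(3), of h]
      by (simp add: restriction_rsg_def)
  qed
  then show ?thesis by (simp add: R.T_proper_iff)
qed

end

section \<open>Isomorphisms between ideals of a semilattice\<close>

context lower_semilattice
begin

lemma le_iff_meet_eq: "\<lbrakk>x \<in> carrier L; y \<in> carrier L\<rbrakk> \<Longrightarrow> x \<sqsubseteq> y \<longleftrightarrow> x \<sqinter> y = x"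
  by (metis le_antisym le_refl meet_closed meet_le meet_left meet_right)

lemma le_meet_iff:
  "\<lbrakk>x \<in> carrier L; y \<in> carrier L; z \<in> carrier L\<rbrakk> \<Longrightarrow> z \<sqsubseteq> x \<sqinter> y \<longleftrightarrow> z \<sqsubseteq> x \<and> z \<sqsubseteq> y"
  by (meson le_trans meet_closed meet_le meet_left meet_right)

definition down :: "'a \<Rightarrow> 'a set" where
  "down e = {x \<in> carrier L. x \<sqsubseteq> e}"

lemma down_inject: "\<lbrakk>e \<in> carrier L; f \<in> carrier L; down e = down f\<rbrakk> \<Longrightarrow> e = f"
  unfolding down_def using le_antisym le_refl by blast

lemma principal_ideal_iff: "principal_ideal L I \<longleftrightarrow> (\<exists>e\<in>carrier L. I = down e)"
  by (simp add: principal_ideal_def down_def)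

lemma ideal_down: "e \<in> carrier L \<Longrightarrow> semilattice_ideal L (down e)"
  unfolding semilattice_ideal_def down_def using le_trans by blast

lemma ideal_closed: "\<lbrakk>semilattice_ideal L I; x \<in> I\<rbrakk> \<Longrightarrow> x \<in> carrier L"
  by (auto simp: semilattice_ideal_def)

lemma ideal_down_closed: "\<lbrakk>semilattice_ideal L I; y \<in> I; x \<in> carrier L; x \<sqsubseteq> y\<rbrakk> \<Longrightarrow> x \<in> I"
  by (auto simp: semilattice_ideal_def)

lemma ideal_meet:
  assumes "semilattice_ideal L I" "x \<in> I" "y \<in> carrier L"
  shows "x \<sqinter> y \<in> I" "y \<sqinter> x \<in> I"
proof -
  have "x \<in> carrier L" using assms ideal_closed by blast
  then show "x \<sqinter> y \<in> I" using assms ideal_down_closed meet_left meet_closed by blast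
  then show "y \<sqinter> x \<in> I" by (subst meet_comm)
qed

text \<open>Rephrases the meet condition from \<open>the\<close> to \<open>Some\<close>. From left
  to right this requires the meet of two domain elements to be in the domain, which the ideal
  property provides.\<close>

lemma TI_set_iff:
  "\<beta> \<in> TI_set L \<longleftrightarrow> semilattice_ideal L (dom \<beta>) \<and> semilattice_ideal L (ran \<beta>) \<and>
     inj_on \<beta> (dom \<beta>) \<and>
     (\<forall>x y x' y'. \<beta> x = Some x' \<longrightarrow> \<beta> y = Some y' \<longrightarrow> \<beta> (x \<sqinter> y) = Some (x' \<sqinter> y'))"
proof (cases "semilattice_ideal L (dom \<beta>)")
  case True
  have ex: "x \<sqinter> y \<in> dom \<beta>" if "x \<in> dom \<beta>" "y \<in> dom \<beta>" for x y
    by (rule ideal_meet(1)[OF True that(1) ideal_closed[OF True that(2)]])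
  have "(\<forall>x\<in>dom \<beta>. \<forall>y\<in>dom \<beta>. the (\<beta> (x \<sqinter> y)) = the (\<beta> x) \<sqinter> the (\<beta> y)) \<longleftrightarrow>
    (\<forall>x y x' y'. \<beta> x = Some x' \<longrightarrow> \<beta> y = Some y' \<longrightarrow> \<beta> (x \<sqinter> y) = Some (x' \<sqinter> y'))"
    (is "?l \<longleftrightarrow> ?r")
  proof
    assume l: ?l
    show ?r
    proof (intro allI impI)
      fix x y x' y' assume "\<beta> x = Some x'" "\<beta> y = Some y'"
      moreover from this obtain z where "\<beta> (x \<sqinter> y) = Some z" using ex[of x y] by blast
      ultimately show "\<beta> (x \<sqinter> y) = Some (x' \<sqinter> y')" using l[rule_format, of x y] by auto
    qed
  next
    assume ?r then show ?l by (auto simp: in_dom_iff)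
  qed
  then show ?thesis unfolding TI_set_def by simp
qed (simp add: TI_set_def)

lemma TI_inj: "\<lbrakk>\<beta> \<in> TI_set L; \<beta> x = Some z; \<beta> y = Some z\<rbrakk> \<Longrightarrow> x = y"
  by (auto simp: TI_set_iff inj_on_dom_iff)

lemma TI_meet: "\<lbrakk>\<beta> \<in> TI_set L; \<beta> x = Some x'; \<beta> y = Some y'\<rbrakk> \<Longrightarrow> \<beta> (x \<sqinter> y) = Some (x' \<sqinter> y')"
  by (auto simp: TI_set_iff)

lemma TI_dom_ideal: "\<beta> \<in> TI_set L \<Longrightarrow> semilattice_ideal L (dom \<beta>)"
  by (simp add: TI_set_iff)

lemma TI_ran_ideal: "\<beta> \<in> TI_set L \<Longrightarrow> semilattice_ideal L (ran \<beta>)"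
  by (simp add: TI_set_iff)

lemma TI_closed:
  assumes "\<beta> \<in> TI_set L" "\<beta> x = Some y" shows "x \<in> carrier L" "y \<in> carrier L"
  using assms TI_dom_ideal TI_ran_ideal ideal_closed by (blast intro: ranI)+

text \<open>The order is read off from meets, which \<open>\<beta>\<close> preserves; injectivity
  gives the passage from values back to arguments.\<close>

lemma TI_le_iff:
  assumes "\<beta> \<in> TI_set L" "\<beta> x = Some x'" "\<beta> y = Some y'"
  shows "x' \<sqsubseteq> y' \<longleftrightarrow> x \<sqsubseteq> y"
  using TI_closed[OF assms(1)] assms TI_meet[OF assms] TI_inj[OF assms(1)]
  by (metis le_iff_meet_eq option.inject)

lemma TI_dom_down:
  assumes "\<beta> \<in> TI_set L" "\<beta> y = Some y'" "x \<in> carrier L" "x \<sqsubseteq> y"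
  obtains x' where "\<beta> x = Some x'" "x' \<in> carrier L" "x' \<sqsubseteq> y'"
  using assms ideal_down_closed[OF TI_dom_ideal] TI_closed TI_le_iff by (metis in_dom_iff)

lemma TI_ran_down:
  assumes "\<beta> \<in> TI_set L" "\<beta> y = Some y'" "x' \<in> carrier L" "x' \<sqsubseteq> y'"
  obtains x where "\<beta> x = Some x'" "x \<in> carrier L" "x \<sqsubseteq> y"
  using assms ideal_down_closed[OF TI_ran_ideal] TI_closed TI_le_iff by (metis in_ran_iff)

lemma TI_pcomp_closed:
  assumes \<beta>: "\<beta> \<in> TI_set L" and \<gamma>: "\<gamma> \<in> TI_set L"
  shows "pcomp \<beta> \<gamma> \<in> TI_set L"
  unfolding TI_set_iff
proof (intro conjI allI impI)
  \<comment> \<open>The composite is nonempty because any two ideals intersect: the meet of an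
    element of \<open>ran \<beta>\<close> with an element of \<open>dom \<gamma>\<close> lies in
    both.\<close>
  obtain b c where bc: "b \<in> ran \<beta>" "c \<in> dom \<gamma>"
    using TI_ran_ideal[OF \<beta>] TI_dom_ideal[OF \<gamma>] unfolding semilattice_ideal_def by blast
  then have "b \<sqinter> c \<in> ran \<beta>" "b \<sqinter> c \<in> dom \<gamma>"
    using ideal_meet ideal_closed TI_ran_ideal[OF \<beta>] TI_dom_ideal[OF \<gamma>] by metis+
  then obtain a d where "\<beta> a = Some (b \<sqinter> c)" "\<gamma> (b \<sqinter> c) = Some d"
    by (auto simp: in_ran_iff)
  then have ne: "pcomp \<beta> \<gamma> a = Some d" by (auto simp: pcomp_Some)
  show "semilattice_ideal L (dom (pcomp \<beta> \<gamma>))"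
    unfolding semilattice_ideal_def
  proof (intro conjI ballI impI)
    show "dom (pcomp \<beta> \<gamma>) \<subseteq> carrier L"
      using TI_closed[OF \<beta>] by (auto simp: pcomp_Some)
    show "dom (pcomp \<beta> \<gamma>) \<noteq> {}" using ne by auto
  next
    fix y x assume *: "y \<in> dom (pcomp \<beta> \<gamma>)" "x \<in> carrier L" "x \<sqsubseteq> y"
    then obtain y' y'' where y: "\<beta> y = Some y'" "\<gamma> y' = Some y''"
      by (auto simp: pcomp_Some)
    then obtain x' where x': "\<beta> x = Some x'" "x' \<in> carrier L" "x' \<sqsubseteq> y'"
      using TI_dom_down[OF \<beta>] * by metis
    then obtain x'' where "\<gamma> x' = Some x''" using TI_dom_down[OF \<gamma> y(2)] by metis
    then show "x \<in> dom (pcomp \<beta> \<gamma>)" using x' by (auto simp: in_dom_iff pcomp_Some)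
  qed
  show "semilattice_ideal L (ran (pcomp \<beta> \<gamma>))"
    unfolding semilattice_ideal_def
  proof (intro conjI ballI impI)
    show "ran (pcomp \<beta> \<gamma>) \<subseteq> carrier L"
      using TI_closed[OF \<gamma>] by (auto simp: in_ran_iff pcomp_Some)
    show "ran (pcomp \<beta> \<gamma>) \<noteq> {}" using ne by (auto simp: ran_def)
  next
    fix y x assume *: "y \<in> ran (pcomp \<beta> \<gamma>)" "x \<in> carrier L" "x \<sqsubseteq> y"
    then obtain y' y'' where y: "\<beta> y'' = Some y'" "\<gamma> y' = Some y"
      by (auto simp: in_ran_iff pcomp_Some)
    then obtain x' where x': "\<gamma> x' = Some x" "x' \<in> carrier L" "x' \<sqsubseteq> y'"
      using TI_ran_down[OF \<gamma>] * by metis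
    then obtain x'' where "\<beta> x'' = Some x'" using TI_ran_down[OF \<beta> y(1)] by metis
    then show "x \<in> ran (pcomp \<beta> \<gamma>)" using x' by (auto simp: in_ran_iff pcomp_Some)
  qed
  show "inj_on (pcomp \<beta> \<gamma>) (dom (pcomp \<beta> \<gamma>))"
    unfolding inj_on_dom_iff
  proof (intro allI impI)
    fix x x' z assume "pcomp \<beta> \<gamma> x = Some z" "pcomp \<beta> \<gamma> x' = Some z"
    then obtain y y' where y: "\<beta> x = Some y" "\<gamma> y = Some z" "\<beta> x' = Some y'" "\<gamma> y' = Some z"
      by (auto simp: pcomp_Some)
    then have "y = y'" using TI_inj[OF \<gamma>] by blast
    then show "x = x'" using y TI_inj[OF \<beta>] by blast
  qed
next
  fix x y x' y' assume "pcomp \<beta> \<gamma> x = Some x'" "pcomp \<beta> \<gamma> y = Some y'"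
  then obtain u v where "\<beta> x = Some u" "\<gamma> u = Some x'" "\<beta> y = Some v" "\<gamma> v = Some y'"
    by (auto simp: pcomp_Some)
  then show "pcomp \<beta> \<gamma> (x \<sqinter> y) = Some (x' \<sqinter> y')"
    unfolding pcomp_Some using TI_meet[OF \<beta>] TI_meet[OF \<gamma>] by (intro exI conjI)
qed

text \<open>The conditions of \<open>TI_set_iff\<close> are symmetric in arguments and values, so
  they pass to the converse relation.\<close>

lemma TI_inverse_closed:
  assumes \<beta>: "\<beta> \<in> TI_set L" shows "map_inverse \<beta> \<in> TI_set L"
proof -
  have inj: "inj_on \<beta> (dom \<beta>)" using \<beta> by (simp add: TI_set_iff)
  show ?thesis
    using \<beta> inj_map_inverse[OF inj] TI_meet[OF \<beta>]
    by (simp add: TI_set_iff dom_map_inverse[OF inj] ran_map_inverse[OF inj] map_inverse_Some[OF inj])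
qed

lemma partial_bijections_TI: "partial_bijections (TI_set L)"
  by unfold_locales (auto simp: TI_pcomp_closed TI_inverse_closed, simp add: TI_set_iff)

lemma TI_identity: "semilattice_ideal L I \<Longrightarrow> Some |` I \<in> TI_set L"
proof -
  assume I: "semilattice_ideal L I"
  have "dom (Some |` I) = I" "ran (Some |` I) = I" by (auto simp: partial_map_simps)
  with I show ?thesis
    by (auto simp: TI_set_iff restrict_Some inj_on_def intro: ideal_meet ideal_closed)
qed

section \<open>Isomorphisms between principal ideals\<close>

lemma ran_eq_down:
  assumes \<beta>: "\<beta> \<in> TI_set L" and e: "\<beta> e = Some f" and dom: "dom \<beta> = down e"
  shows "ran \<beta> = down f"
proof (rule Set.set_eqI)
  fix y
  show "y \<in> ran \<beta> \<longleftrightarrow> y \<in> down f"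
  proof
    assume "y \<in> ran \<beta>"
    then obtain x where x: "\<beta> x = Some y" by (auto simp: in_ran_iff)
    then have "x \<sqsubseteq> e" using dom by (auto simp: down_def)
    then show "y \<in> down f" using \<beta> e x TI_le_iff TI_closed by (auto simp: down_def)
  next
    assume "y \<in> down f"
    then obtain x where "\<beta> x = Some y"
      using TI_ran_down[OF \<beta> e, of y] by (auto simp: down_def)
    then show "y \<in> ran \<beta>" by (auto simp: in_ran_iff)
  qed
qed

lemma principal_dom_imp_ran:
  assumes \<beta>: "\<beta> \<in> TI_set L" and "principal_ideal L (dom \<beta>)"
  shows "principal_ideal L (ran \<beta>)"
proof -
  obtain e where e: "e \<in> carrier L" "dom \<beta> = down e"
    using assms by (auto simp: principal_ideal_iff)
  then obtain f where "\<beta> e = Some f" by (auto simp: down_def dest: equalityD2)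
  then show ?thesis
    unfolding principal_ideal_iff using e ran_eq_down \<beta> TI_closed by metis
qed

lemma TP_set_iff: "\<beta> \<in> TP_set L \<longleftrightarrow> \<beta> \<in> TI_set L \<and> principal_ideal L (dom \<beta>)"
  unfolding TP_set_def using principal_dom_imp_ran by blast

lemma TP_imp_TI: "\<beta> \<in> TP_set L \<Longrightarrow> \<beta> \<in> TI_set L"
  by (simp add: TP_set_iff)

lemma TP_top:
  assumes "\<beta> \<in> TP_set L"
  obtains e f where "\<beta> e = Some f" "e \<in> carrier L" "f \<in> carrier L" "dom \<beta> = down e" "ran \<beta> = down f"
proof -
  obtain e where e: "e \<in> carrier L" "dom \<beta> = down e"
    using assms by (auto simp: principal_ideal_iff TP_set_iff)
  then have "e \<in> dom \<beta>" by (simp add: down_def)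
  then obtain f where "\<beta> e = Some f" by blast
  then show thesis using that e ran_eq_down TI_closed TP_imp_TI[OF assms] by metis
qed

lemma TP_pcomp_closed:
  assumes \<beta>: "\<beta> \<in> TP_set L" and \<gamma>: "\<gamma> \<in> TP_set L"
  shows "pcomp \<beta> \<gamma> \<in> TP_set L"
proof -
  note \<beta>' = TP_imp_TI[OF \<beta>] and \<gamma>' = TP_imp_TI[OF \<gamma>]
  obtain b where b: "b \<in> carrier L" "ran \<beta> = down b" using \<beta> by (rule TP_top)
  obtain c where c: "c \<in> carrier L" "dom \<gamma> = down c" using \<gamma> by (rule TP_top)
  \<comment> \<open>The intersection of \<open>ran \<beta>\<close> and \<open>dom \<gamma>\<close>
    is \<open>down (b \<sqinter> c)\<close>, so the composite is defined exactly below the preimage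
    \<open>a\<close> of \<open>b \<sqinter> c\<close>.\<close>
  have "b \<sqinter> c \<in> ran \<beta>" using b c by (simp add: down_def meet_left)
  then obtain a where a: "\<beta> a = Some (b \<sqinter> c)" by (auto simp: in_ran_iff)
  have "dom (pcomp \<beta> \<gamma>) = down a"
  proof (rule Set.set_eqI)
    fix x
    have "x \<in> dom (pcomp \<beta> \<gamma>) \<longleftrightarrow> (\<exists>y. \<beta> x = Some y \<and> y \<in> dom \<gamma>)"
      by (auto simp: partial_map_simps)
    also have "\<dots> \<longleftrightarrow> (\<exists>y. \<beta> x = Some y \<and> y \<sqsubseteq> b \<sqinter> c)"
      using b c TI_closed[OF \<beta>'] by (auto simp: down_def le_meet_iff set_eq_iff in_ran_iff)
    also have "\<dots> \<longleftrightarrow> x \<in> down a"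
      using TI_le_iff[OF \<beta>' _ a] TI_closed[OF \<beta>'] TI_dom_down[OF \<beta>' a]
      unfolding down_def mem_Collect_eq by metis
    finally show "x \<in> dom (pcomp \<beta> \<gamma>) \<longleftrightarrow> x \<in> down a" .
  qed
  then have "principal_ideal L (dom (pcomp \<beta> \<gamma>))"
    unfolding principal_ideal_iff by (rule bexI) (rule TI_closed(1)[OF \<beta>' a])
  then show ?thesis by (simp add: TP_set_iff TI_pcomp_closed[OF \<beta>' \<gamma>'])
qed

lemma partial_bijections_TP: "partial_bijections (TP_set L)"
proof -
  interpret TI: partial_bijections "TI_set L" by (rule partial_bijections_TI)
  show ?thesis
  proof
    fix \<beta> assume \<beta>: "\<beta> \<in> TP_set L"
    then show inj: "inj_on \<beta> (dom \<beta>)" by (rule TI.inj[OF TP_imp_TI])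
    show "map_inverse \<beta> \<in> TP_set L"
      using \<beta> inj TI.inverse_closed[OF TP_imp_TI[OF \<beta>]] by (simp add: TP_set_def dom_map_inverse ran_map_inverse)
  qed (rule TP_pcomp_closed)
qed

lemma restrict_ideal_TI:
  assumes \<beta>: "\<beta> \<in> TI_set L" and I: "semilattice_ideal L I"
  shows "\<beta> |` I \<in> TI_set L"
proof -
  have "\<beta> |` I = pcomp (Some |` I) \<beta>" by (rule map_eqI) (auto simp: partial_map_simps)
  then show ?thesis using TI_pcomp_closed TI_identity \<beta> I by simp
qed

lemma dom_restrict_down:
  assumes \<beta>: "\<beta> \<in> TI_set L" and e: "\<beta> e = Some f"
  shows "dom (\<beta> |` down e) = down e"
proof
  show "down e \<subseteq> dom (\<beta> |` down e)"
  proof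
    fix x assume x: "x \<in> down e"
    then obtain y where "\<beta> x = Some y"
      using TI_dom_down[OF \<beta> e, of x] by (auto simp: down_def)
    then show "x \<in> dom (\<beta> |` down e)" using x by (auto simp: restrict_map_def)
  qed
qed auto

lemma restrict_down_TP:
  assumes \<beta>: "\<beta> \<in> TI_set L" and e: "\<beta> e = Some f"
  shows "\<beta> |` down e \<in> TP_set L"
  unfolding TP_set_iff principal_ideal_iff dom_restrict_down[OF assms]
  using \<beta> TI_closed(1)[OF assms] restrict_ideal_TI ideal_down by blast

lemma ran_restrict_down:
  assumes \<beta>: "\<beta> \<in> TI_set L" and e: "\<beta> e = Some f"
  shows "ran (\<beta> |` down e) = down f"
proof (rule ran_eq_down)
  have "e \<in> carrier L" using TI_closed[OF assms] by simp
  then show "\<beta> |` down e \<in> TI_set L" "(\<beta> |` down e) e = Some f"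
    using assms by (auto simp: restrict_ideal_TI ideal_down restrict_Some) (simp add: down_def)
qed (rule dom_restrict_down[OF assms])

end

section \<open>Subactions on a semilattice\<close>

locale semilattice_subaction = Y: lower_semilattice Y + T: monoid T
  for Y :: "('y, 'w) gorder_scheme" (structure) and T :: "('t, 'c) monoid_scheme" +
  fixes \<alpha> :: "'t \<Rightarrow> ('y \<rightharpoonup> 'y)"
  assumes subhom: "monoidal_subhom T Y \<alpha>"
begin

sublocale TI: partial_bijections "TI_set Y" by (rule Y.partial_bijections_TI)

sublocale TP: partial_bijections "TP_set Y" by (rule Y.partial_bijections_TP)

lemma action_TI: "t \<in> carrier T \<Longrightarrow> \<alpha> t \<in> TI_set Y"
  using subhom by (auto simp: monoidal_subhom_def)

lemma action_one: "\<alpha> \<one>\<^bsub>T\<^esub> = Some |` carrier Y"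
  using subhom by (simp add: monoidal_subhom_def TI_monoid_def)

lemma action_mult:
  assumes "t \<in> carrier T" "u \<in> carrier T"
  shows "pcomp (\<alpha> t) (\<alpha> u) \<subseteq>\<^sub>m \<alpha> (t \<otimes>\<^bsub>T\<^esub> u)"
proof -
  have "natural_le (TI_rsg Y) (pcomp (\<alpha> t) (\<alpha> u)) (\<alpha> (t \<otimes>\<^bsub>T\<^esub> u))"
    using subhom assms by (simp add: monoidal_subhom_def TI_monoid_def)
  then show ?thesis
    using assms by (simp add: TI_rsg_def TI.natural_le_inverse_rsg action_TI)
qed

lemma action_closed:
  assumes "t \<in> carrier T" "\<alpha> t e = Some x" shows "e \<in> carrier Y" "x \<in> carrier Y"
  using Y.TI_closed[OF action_TI] assms by blast+

lemma action_dom_nonempty: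
  assumes t: "t \<in> carrier T" obtains e x where "\<alpha> t e = Some x"
  using Y.TI_dom_ideal[OF action_TI[OF t]] unfolding semilattice_ideal_def by blast

text \<open>This instance models the permissible subsets; each \<open>\<alpha> t\<close> is itself a
  member of the family.\<close>

sublocale XI: partial_subaction "TI_set Y" T \<alpha>
proof
  show "\<And>\<beta>. \<beta> \<in> TI_set Y \<Longrightarrow> Some |` dom \<beta> \<subseteq>\<^sub>m \<alpha> \<one>\<^bsub>T\<^esub>"
    using Y.TI_closed by (auto simp: action_one map_le_iff partial_map_simps)
  show "\<And>t. t \<in> carrier T \<Longrightarrow> \<exists>\<beta>\<in>TI_set Y. \<beta> \<subseteq>\<^sub>m \<alpha> t"
    using action_TI map_le_refl by blast
  show "\<And>t. t \<in> carrier T \<Longrightarrow> inj_on (\<alpha> t) (dom (\<alpha> t))"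
    using TI.inj action_TI by blast
qed (rule action_mult)

sublocale XP: partial_subaction "TP_set Y" T \<alpha>
proof
  show "\<And>\<beta>. \<beta> \<in> TP_set Y \<Longrightarrow> Some |` dom \<beta> \<subseteq>\<^sub>m \<alpha> \<one>\<^bsub>T\<^esub>"
    using XI.action_one Y.TP_imp_TI by blast
  show "\<exists>\<beta>\<in>TP_set Y. \<beta> \<subseteq>\<^sub>m \<alpha> t" if t: "t \<in> carrier T" for t
  proof -
    \<comment> \<open>\<open>\<alpha> t\<close> may fail to be in \<open>TP_set Y\<close>, but its
      restriction below any point of its domain is a member.\<close>
    obtain e x where "\<alpha> t e = Some x" using action_dom_nonempty[OF t] .
    then have "\<alpha> t |` Y.down e \<in> TP_set Y" using Y.restrict_down_TP action_TI t by blast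
    then show ?thesis by (rule bexI[rotated]) (auto simp: map_le_iff restrict_Some)
  qed
  show "\<And>t. t \<in> carrier T \<Longrightarrow> inj_on (\<alpha> t) (dom (\<alpha> t))"
    by (rule XI.action_inj)
qed (rule action_mult)

section \<open>The operations of W\<close>

lemma act_eq: "\<alpha> t e = Some x \<Longrightarrow> act \<alpha> e t = x"
  by (simp add: act_def)

lemma act_pre_eq:
  assumes "t \<in> carrier T" "\<alpha> t e = Some x" shows "act_pre \<alpha> x t = e"
  unfolding act_pre_def act_def
  using assms Y.TI_inj[OF action_TI[OF assms(1)]] by (intro the_equality) auto

lemma W_carrier: "(t, x) \<in> carrier (W_rsg T Y \<alpha>) \<longleftrightarrow> t \<in> carrier T \<and> (\<exists>e. \<alpha> t e = Some x)"
  by (auto simp: W_rsg_def act_def) (metis domI option.sel)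

lemma W_plus:
  "\<lbrakk>t \<in> carrier T; \<alpha> t e = Some x\<rbrakk> \<Longrightarrow> rplus (W_rsg T Y \<alpha>) (t, x) = (\<one>\<^bsub>T\<^esub>, e)"
  by (simp add: W_rsg_def act_pre_eq)

lemma W_star: "rstar (W_rsg T Y \<alpha>) (t, x) = (\<one>\<^bsub>T\<^esub>, x)"
  by (simp add: W_rsg_def)

text \<open>The witness \<open>k\<close> is the preimage of \<open>x \<sqinter> f\<close> under
  \<open>\<alpha> t\<close>. The composite of \<open>\<alpha> t\<close> and
  \<open>\<alpha> u\<close> sends it to \<open>z\<close>, and the subhomomorphism property says that
  the action of the product of \<open>t\<close> and \<open>u\<close> does so too; hence
  \<open>k\<close> is the argument that \<open>rplus\<close> assigns to the product.\<close>

lemma W_mult: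
  assumes t: "t \<in> carrier T" and e: "\<alpha> t e = Some x" and u: "u \<in> carrier T" and f: "\<alpha> u f = Some g"
  obtains k z where "\<alpha> t k = Some (x \<sqinter> f)" "\<alpha> u (x \<sqinter> f) = Some z" "\<alpha> (t \<otimes>\<^bsub>T\<^esub> u) k = Some z"
    "(t, x) \<cdot>\<^bsub>W_rsg T Y \<alpha>\<^esub> (u, g) = (t \<otimes>\<^bsub>T\<^esub> u, z)"
proof -
  have xf: "x \<in> carrier Y" "f \<in> carrier Y" using action_closed t e u f by blast+
  then have m: "x \<sqinter> f \<in> carrier Y" "x \<sqinter> f \<sqsubseteq> x" "x \<sqinter> f \<sqsubseteq> f"
    by (auto intro: Y.meet_left Y.meet_right)
  obtain k where k: "\<alpha> t k = Some (x \<sqinter> f)"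
    using Y.TI_ran_down[OF action_TI[OF t] e m(1,2)] .
  obtain z where z: "\<alpha> u (x \<sqinter> f) = Some z"
    using Y.TI_dom_down[OF action_TI[OF u] f m(1,3)] .
  have "pcomp (\<alpha> t) (\<alpha> u) k = Some z" using k z by (auto simp: pcomp_Some)
  then have "\<alpha> (t \<otimes>\<^bsub>T\<^esub> u) k = Some z" using action_mult[OF t u] by (auto simp: map_le_iff)
  moreover have "(t, x) \<cdot>\<^bsub>W_rsg T Y \<alpha>\<^esub> (u, g) = (t \<otimes>\<^bsub>T\<^esub> u, z)"
    using act_pre_eq[OF u f] act_eq[OF z] by (simp add: W_rsg_def)
  ultimately show thesis using that k z by blast
qed

lemma action_one_Some: "\<alpha> \<one>\<^bsub>T\<^esub> e = Some x \<longleftrightarrow> e \<in> carrier Y \<and> x = e"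
  by (auto simp: action_one restrict_Some)

text \<open>Closure is shown directly, since \<open>rsg_iso_sym\<close> requires it before the
  identities can be imported from the model by partial maps.\<close>

lemma W_closed:
  shows "\<lbrakk>a \<in> carrier (W_rsg T Y \<alpha>); b \<in> carrier (W_rsg T Y \<alpha>)\<rbrakk>
      \<Longrightarrow> a \<cdot>\<^bsub>W_rsg T Y \<alpha>\<^esub> b \<in> carrier (W_rsg T Y \<alpha>)"
    and "a \<in> carrier (W_rsg T Y \<alpha>) \<Longrightarrow> rplus (W_rsg T Y \<alpha>) a \<in> carrier (W_rsg T Y \<alpha>)"
    and "a \<in> carrier (W_rsg T Y \<alpha>) \<Longrightarrow> rstar (W_rsg T Y \<alpha>) a \<in> carrier (W_rsg T Y \<alpha>)"
proof -
  assume a: "a \<in> carrier (W_rsg T Y \<alpha>)"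
  obtain t x where tx: "a = (t, x)" by (cases a)
  obtain e where e: "t \<in> carrier T" "\<alpha> t e = Some x" using a tx W_carrier by auto
  show "rplus (W_rsg T Y \<alpha>) a \<in> carrier (W_rsg T Y \<alpha>)"
    using e action_closed[OF e] by (simp add: tx W_plus W_carrier action_one_Some)
  show "rstar (W_rsg T Y \<alpha>) a \<in> carrier (W_rsg T Y \<alpha>)"
    using e action_closed[OF e] by (simp add: tx W_star W_carrier action_one_Some)
  assume b: "b \<in> carrier (W_rsg T Y \<alpha>)"
  obtain u g where ug: "b = (u, g)" by (cases b)
  obtain f where f: "u \<in> carrier T" "\<alpha> u f = Some g" using b ug W_carrier by auto
  show "a \<cdot>\<^bsub>W_rsg T Y \<alpha>\<^esub> b \<in> carrier (W_rsg T Y \<alpha>)"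
    using W_mult[OF e f] e(1) f(1) unfolding tx ug by (metis T.m_closed W_carrier)
qed

section \<open>W as a semigroup of restrictions of the action\<close>

definition W_to_maps :: "'t \<times> 'y \<Rightarrow> ('y \<rightharpoonup> 'y) \<times> 't" where
  "W_to_maps = (\<lambda>(t, x). (\<alpha> t |` Y.down (act_pre \<alpha> x t), t))"

lemma W_to_maps_eq:
  "\<lbrakk>t \<in> carrier T; \<alpha> t e = Some x\<rbrakk> \<Longrightarrow> W_to_maps (t, x) = (\<alpha> t |` Y.down e, t)"
  by (simp add: W_to_maps_def act_pre_eq)

text \<open>Both sides are restrictions of the action of the product, so it is enough to compare
  domains: \<open>a\<close> belongs to either exactly when \<open>\<alpha> t\<close> sends it below
  \<open>x \<sqinter> f\<close>.\<close>

lemma W_to_maps_mult: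
  assumes t: "t \<in> carrier T" and e: "\<alpha> t e = Some x" and u: "u \<in> carrier T" and f: "\<alpha> u f = Some g"
    and k: "\<alpha> t k = Some (x \<sqinter> f)" and z: "\<alpha> (t \<otimes>\<^bsub>T\<^esub> u) k = Some z"
  shows "\<alpha> (t \<otimes>\<^bsub>T\<^esub> u) |` Y.down k = pcomp (\<alpha> t |` Y.down e) (\<alpha> u |` Y.down f)"
proof (rule map_le_same_dom)
  note T = action_TI[OF t] and U = action_TI[OF u] and TU = action_TI[OF T.m_closed[OF t u]]
  show "\<alpha> (t \<otimes>\<^bsub>T\<^esub> u) |` Y.down k \<subseteq>\<^sub>m \<alpha> (t \<otimes>\<^bsub>T\<^esub> u)"
    by (auto simp: map_le_iff restrict_Some)
  show "pcomp (\<alpha> t |` Y.down e) (\<alpha> u |` Y.down f) \<subseteq>\<^sub>m \<alpha> (t \<otimes>\<^bsub>T\<^esub> u)"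
    by (rule XI.pcomp_le_action[OF t u]) (auto simp: map_le_iff restrict_Some)
  have cl: "x \<in> carrier Y" "f \<in> carrier Y" "e \<in> carrier Y" using action_closed t e u f by blast+
  have "a \<in> Y.down k \<longleftrightarrow> a \<in> dom (pcomp (\<alpha> t |` Y.down e) (\<alpha> u |` Y.down f))" for a
  proof
    assume a: "a \<in> Y.down k"
    then obtain a' where a': "\<alpha> t a = Some a'" "a' \<in> carrier Y" "a' \<sqsubseteq> x \<sqinter> f"
      using Y.TI_dom_down[OF T k, of a] by (auto simp: Y.down_def)
    then have le: "a' \<sqsubseteq> x" "a' \<sqsubseteq> f" using cl by (simp_all add: Y.le_meet_iff)
    have "a \<sqsubseteq> e" using Y.TI_le_iff[OF T a'(1) e] le by simp
    moreover obtain b where "\<alpha> u a' = Some b" using Y.TI_dom_down[OF U f a'(2) le(2)] .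
    ultimately show "a \<in> dom (pcomp (\<alpha> t |` Y.down e) (\<alpha> u |` Y.down f))"
      using a a' le by (auto simp: partial_map_simps Y.down_def)
  next
    assume "a \<in> dom (pcomp (\<alpha> t |` Y.down e) (\<alpha> u |` Y.down f))"
    then obtain a' where a': "a \<in> carrier Y" "a \<sqsubseteq> e" "\<alpha> t a = Some a'" "a' \<in> carrier Y" "a' \<sqsubseteq> f"
      by (auto simp: partial_map_simps Y.down_def)
    then have "a' \<sqsubseteq> x" using Y.TI_le_iff[OF T a'(3) e] by simp
    then have "a' \<sqsubseteq> x \<sqinter> f" using a' cl by (simp add: Y.le_meet_iff)
    then show "a \<in> Y.down k" using Y.TI_le_iff[OF T a'(3) k] a' by (simp add: Y.down_def)
  qed
  then show "dom (\<alpha> (t \<otimes>\<^bsub>T\<^esub> u) |` Y.down k) = dom (pcomp (\<alpha> t |` Y.down e) (\<alpha> u |` Y.down f))"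
    unfolding Y.dom_restrict_down[OF TU z] by blast
qed

lemma W_to_maps_iso: "W_to_maps \<in> rsg_iso (W_rsg T Y \<alpha>) (restriction_rsg (TP_set Y) T \<alpha>)"
proof -
  let ?W = "W_rsg T Y \<alpha>" and ?X = "restriction_rsg (TP_set Y) T \<alpha>"
  have "inj_on W_to_maps (carrier ?W)"
  proof (rule inj_onI)
    fix a b assume "a \<in> carrier ?W" "b \<in> carrier ?W" and eq: "W_to_maps a = W_to_maps b"
    moreover obtain t x u y where ab: "a = (t, x)" "b = (u, y)" by (cases a, cases b)
    ultimately obtain e f where e: "t \<in> carrier T" "\<alpha> t e = Some x"
      and f: "u \<in> carrier T" "\<alpha> u f = Some y" using W_carrier by blast
    have tu: "t = u" and "\<alpha> t |` Y.down e = \<alpha> t |` Y.down f"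
      using eq by (auto simp: ab W_to_maps_eq[OF e] W_to_maps_eq[OF f])
    then have "Y.down e = Y.down f"
      using Y.dom_restrict_down[OF action_TI] e f by metis
    then have "e = f" using Y.down_inject action_closed e f by blast
    then show "a = b" using ab e f tu by simp
  qed
  moreover have "W_to_maps ` carrier ?W = carrier ?X"
  proof (intro equalityI subsetI)
    fix p assume "p \<in> W_to_maps ` carrier ?W"
    then obtain t x where "p = W_to_maps (t, x)" "(t, x) \<in> carrier ?W" by auto
    then obtain e where e: "t \<in> carrier T" "\<alpha> t e = Some x" "p = (\<alpha> t |` Y.down e, t)"
      using W_carrier W_to_maps_eq by metis
    then show "p \<in> carrier ?X"
      using Y.restrict_down_TP[OF action_TI] by (auto simp: restriction_rsg_def map_le_iff restrict_Some)
  next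
    fix p assume "p \<in> carrier ?X"
    then obtain \<beta> t where p: "p = (\<beta>, t)" "\<beta> \<in> TP_set Y" "t \<in> carrier T" "\<beta> \<subseteq>\<^sub>m \<alpha> t"
      by (auto simp: restriction_rsg_def)
    \<comment> \<open>A map below \<open>\<alpha> t\<close> with a principal domain is determined by
      the top \<open>e\<close> of that domain, so its preimage in \<open>W_rsg\<close> is
      \<open>(t, x)\<close> with \<open>x\<close> the value at \<open>e\<close>.\<close>
    obtain e x where e: "\<beta> e = Some x" "dom \<beta> = Y.down e" using Y.TP_top[OF p(2)] by metis
    then have x: "\<alpha> t e = Some x" using p by (simp add: map_le_iff)
    have "\<beta> = \<alpha> t |` Y.down e"
      using p(4) Y.dom_restrict_down[OF action_TI[OF p(3)] x] e(2)
      by (intro map_le_same_dom[of _ "\<alpha> t"]) (auto simp: map_le_iff restrict_Some)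
    then have "p = W_to_maps (t, x)" using p x W_to_maps_eq by simp
    moreover have "(t, x) \<in> carrier ?W" using p x W_carrier by blast
    ultimately show "p \<in> W_to_maps ` carrier ?W" by blast
  qed
  moreover have "W_to_maps (a \<cdot>\<^bsub>?W\<^esub> b) = W_to_maps a \<cdot>\<^bsub>?X\<^esub> W_to_maps b"
    if ab: "a \<in> carrier ?W" "b \<in> carrier ?W" for a b
  proof -
    obtain t x u g where eq: "a = (t, x)" "b = (u, g)" by (cases a, cases b)
    with ab obtain e f where e: "t \<in> carrier T" "\<alpha> t e = Some x"
      and f: "u \<in> carrier T" "\<alpha> u f = Some g" using W_carrier by blast
    obtain k z where k: "\<alpha> t k = Some (x \<sqinter> f)" and z: "\<alpha> (t \<otimes>\<^bsub>T\<^esub> u) k = Some z"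
      and m: "(t, x) \<cdot>\<^bsub>?W\<^esub> (u, g) = (t \<otimes>\<^bsub>T\<^esub> u, z)" using W_mult[OF e f] .
    show ?thesis
      unfolding eq m W_to_maps_eq[OF e] W_to_maps_eq[OF f] W_to_maps_eq[OF T.m_closed[OF e(1) f(1)] z]
        W_to_maps_mult[OF e f k z] by (simp add: restriction_rsg_def)
  qed
  moreover have "W_to_maps (rplus ?W a) = rplus ?X (W_to_maps a) \<and>
      W_to_maps (rstar ?W a) = rstar ?X (W_to_maps a)" if a: "a \<in> carrier ?W" for a
  proof -
    obtain t x where eq: "a = (t, x)" by (cases a)
    with a obtain e where e: "t \<in> carrier T" "\<alpha> t e = Some x" using W_carrier by blast
    have one: "\<alpha> \<one>\<^bsub>T\<^esub> |` Y.down y = Some |` Y.down y" for y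
      by (rule map_eqI) (auto simp: restrict_Some action_one_Some Y.down_def)
    have "W_to_maps (\<one>\<^bsub>T\<^esub>, y) = (Some |` Y.down y, \<one>\<^bsub>T\<^esub>)" if "y \<in> carrier Y" for y
      using that W_to_maps_eq[OF T.one_closed, of y y] by (simp add: action_one_Some one)
    then show ?thesis
      unfolding eq W_plus[OF e] W_star W_to_maps_eq[OF e]
      using action_closed[OF e] Y.dom_restrict_down[OF action_TI e(2)]
        Y.ran_restrict_down[OF action_TI e(2)] e(1)
      by (simp add: restriction_rsg_def del: dom_restrict)
  qed
  ultimately show ?thesis unfolding rsg_iso_def bij_betw_def by blast
qed

lemma maps_to_W_iso:
  "inv_into (carrier (W_rsg T Y \<alpha>)) W_to_maps \<in> rsg_iso (restriction_rsg (TP_set Y) T \<alpha>) (W_rsg T Y \<alpha>)"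
  using rsg_iso_sym[OF W_to_maps_iso] W_closed by blast

lemma W_restriction_semigroup: "restriction_semigroup (W_rsg T Y \<alpha>)"
  using restriction_semigroup_iso XP.restriction_semigroup maps_to_W_iso by blast

text \<open>\<open>rstar\<close> keeps the second coordinate, and \<open>rplus\<close> gives the
  argument whose value under \<open>\<alpha> t\<close> is that coordinate; this yields both
  injectivity axioms.\<close>

sublocale W: proper_cover "W_rsg T Y \<alpha>" T fst
proof (intro proper_cover.intro W_restriction_semigroup T.monoid_axioms proper_cover_axioms.intro)
  show "fst ` carrier (W_rsg T Y \<alpha>) = carrier T"
  proof (intro equalityI subsetI)
    fix t assume t: "t \<in> carrier T"
    obtain e x where "\<alpha> t e = Some x" using action_dom_nonempty[OF t] .
    then have "(t, x) \<in> carrier (W_rsg T Y \<alpha>)" using t W_carrier by blast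
    then show "t \<in> fst ` carrier (W_rsg T Y \<alpha>)" by force
  qed (auto simp: W_carrier)
next
  fix a b assume ab: "a \<in> carrier (W_rsg T Y \<alpha>)" "b \<in> carrier (W_rsg T Y \<alpha>)" "fst a = fst b"
  then obtain t x y where eq: "a = (t, x)" "b = (t, y)" by (cases a, cases b) auto
  then obtain e f where e: "t \<in> carrier T" "\<alpha> t e = Some x" and f: "\<alpha> t f = Some y"
    using ab W_carrier by blast
  show "a = b" if "rplus (W_rsg T Y \<alpha>) a = rplus (W_rsg T Y \<alpha>) b"
    using that e f by (simp add: eq W_plus[OF e] W_plus[OF e(1) f])
  show "a = b" if "rstar (W_rsg T Y \<alpha>) a = rstar (W_rsg T Y \<alpha>) b"
    using that by (simp add: eq W_star)
qed (auto simp: W_rsg_def)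

section \<open>Projections, natural order and permissible subsets of W\<close>

lemma projections_W: "projections (W_rsg T Y \<alpha>) = {\<one>\<^bsub>T\<^esub>} \<times> carrier Y"
proof (intro equalityI subsetI)
  fix p assume "p \<in> projections (W_rsg T Y \<alpha>)"
  then obtain t x where "(t, x) \<in> carrier (W_rsg T Y \<alpha>)" "p = rplus (W_rsg T Y \<alpha>) (t, x)"
    unfolding projections_def by auto
  then show "p \<in> {\<one>\<^bsub>T\<^esub>} \<times> carrier Y" using W_carrier W_plus action_closed by auto
next
  fix p assume "p \<in> {\<one>\<^bsub>T\<^esub>} \<times> carrier Y"
  then obtain e where p: "p = (\<one>\<^bsub>T\<^esub>, e)" "e \<in> carrier Y" by blast
  then have "p = rplus (W_rsg T Y \<alpha>) p" "p \<in> carrier (W_rsg T Y \<alpha>)"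
    using W_plus[of "\<one>\<^bsub>T\<^esub>" e e] W_carrier by (simp_all add: action_one_Some)
  then show "p \<in> projections (W_rsg T Y \<alpha>)" unfolding projections_def by blast
qed

lemma projection_mult_W:
  assumes "e \<in> carrier Y" and u: "u \<in> carrier T" and f: "\<alpha> u f = Some g"
  obtains z where "\<alpha> u (e \<sqinter> f) = Some z" "(\<one>\<^bsub>T\<^esub>, e) \<cdot>\<^bsub>W_rsg T Y \<alpha>\<^esub> (u, g) = (u, z)"
proof -
  have "\<alpha> \<one>\<^bsub>T\<^esub> e = Some e" using assms by (simp add: action_one_Some)
  from W_mult[OF T.one_closed this u f] show thesis using u that by (metis T.l_one)
qed

lemma projections_W_semilattice:
  "\<exists>\<phi>. bij_betw \<phi> (projections (W_rsg T Y \<alpha>)) (carrier Y) \<and>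
    (\<forall>p\<in>projections (W_rsg T Y \<alpha>). \<forall>q\<in>projections (W_rsg T Y \<alpha>).
       \<phi> (p \<cdot>\<^bsub>W_rsg T Y \<alpha>\<^esub> q) = \<phi> p \<sqinter> \<phi> q)"
proof (intro exI conjI ballI)
  show "bij_betw snd (projections (W_rsg T Y \<alpha>)) (carrier Y)"
    unfolding projections_W bij_betw_def by (auto simp: inj_on_def)
next
  fix p q assume "p \<in> projections (W_rsg T Y \<alpha>)" "q \<in> projections (W_rsg T Y \<alpha>)"
  then obtain e f where ef: "p = (\<one>\<^bsub>T\<^esub>, e)" "q = (\<one>\<^bsub>T\<^esub>, f)" "e \<in> carrier Y" "f \<in> carrier Y"
    unfolding projections_W by blast
  then have "\<alpha> \<one>\<^bsub>T\<^esub> f = Some f" by (simp add: action_one_Some)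
  then obtain z where "\<alpha> \<one>\<^bsub>T\<^esub> (e \<sqinter> f) = Some z" "p \<cdot>\<^bsub>W_rsg T Y \<alpha>\<^esub> q = (\<one>\<^bsub>T\<^esub>, z)"
    using projection_mult_W[OF ef(3) T.one_closed] unfolding ef by metis
  then show "snd (p \<cdot>\<^bsub>W_rsg T Y \<alpha>\<^esub> q) = snd p \<sqinter> snd q"
    using ef by (simp add: action_one_Some)
qed

text \<open>Multiplying by a projection with second coordinate \<open>e\<close> moves the argument
  from \<open>f\<close> down to \<open>e \<sqinter> f\<close>. As \<open>\<alpha> u\<close> is an
  order isomorphism between ideals, this reaches exactly the second coordinates below
  \<open>b\<close>.\<close>

lemma natural_le_W:
  assumes t: "t \<in> carrier T" and u: "u \<in> carrier T" and f: "\<alpha> u f = Some b"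
  shows "natural_le (W_rsg T Y \<alpha>) (t, a) (u, b) \<longleftrightarrow> t = u \<and> a \<in> carrier Y \<and> a \<sqsubseteq> b"
proof
  note fb = action_closed[OF u f]
  assume "natural_le (W_rsg T Y \<alpha>) (t, a) (u, b)"
  then obtain e where e: "e \<in> carrier Y" "(t, a) = (\<one>\<^bsub>T\<^esub>, e) \<cdot>\<^bsub>W_rsg T Y \<alpha>\<^esub> (u, b)"
    unfolding natural_le_def projections_W by blast
  obtain z where z: "\<alpha> u (e \<sqinter> f) = Some z" "(\<one>\<^bsub>T\<^esub>, e) \<cdot>\<^bsub>W_rsg T Y \<alpha>\<^esub> (u, b) = (u, z)"
    using projection_mult_W[OF e(1) u f] .
  moreover have "z \<sqsubseteq> b"
    using Y.TI_le_iff[OF action_TI[OF u] z(1) f] Y.meet_right[OF e(1) fb(1)] by simp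
  ultimately show "t = u \<and> a \<in> carrier Y \<and> a \<sqsubseteq> b" using e action_closed u by auto
next
  assume a: "t = u \<and> a \<in> carrier Y \<and> a \<sqsubseteq> b"
  then obtain k where k: "\<alpha> u k = Some a" "k \<in> carrier Y" "k \<sqsubseteq> f"
    using Y.TI_ran_down[OF action_TI[OF u] f, of a] by blast
  then have "k \<sqinter> f = k" using Y.le_iff_meet_eq action_closed[OF u f] by blast
  moreover obtain z where "\<alpha> u (k \<sqinter> f) = Some z" "(\<one>\<^bsub>T\<^esub>, k) \<cdot>\<^bsub>W_rsg T Y \<alpha>\<^esub> (u, b) = (u, z)"
    using projection_mult_W[OF k(2) u f] .
  ultimately have "(t, a) = (\<one>\<^bsub>T\<^esub>, k) \<cdot>\<^bsub>W_rsg T Y \<alpha>\<^esub> (u, b)" using a k by simp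
  then show "natural_le (W_rsg T Y \<alpha>) (t, a) (u, b)"
    unfolding natural_le_def projections_W using k by blast
qed

text \<open>Compatibility forces equal first coordinates, because projections lie over the identity
  of \<open>T\<close>; the second coordinates then form an ideal by \<open>natural_le_W\<close>.
  Conversely, elements over the same \<open>t\<close> are compatible in any proper cover.\<close>

lemma permissible_W_iff:
  "permissible (W_rsg T Y \<alpha>) A \<longleftrightarrow>
    (\<exists>t I. t \<in> carrier T \<and> semilattice_ideal Y I \<and> I \<subseteq> ran (\<alpha> t) \<and> A = {t} \<times> I)"
proof
  assume perm: "permissible (W_rsg T Y \<alpha>) A"
  then have sub: "A \<subseteq> carrier (W_rsg T Y \<alpha>)" and ne: "A \<noteq> {}"
    and down: "\<And>a b. \<lbrakk>b \<in> A; a \<in> carrier (W_rsg T Y \<alpha>); natural_le (W_rsg T Y \<alpha>) a b\<rbrakk> \<Longrightarrow> a \<in> A"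
    and comp: "\<And>a b. \<lbrakk>a \<in> A; b \<in> A\<rbrakk> \<Longrightarrow>
      rplus (W_rsg T Y \<alpha>) a \<cdot>\<^bsub>W_rsg T Y \<alpha>\<^esub> b = rplus (W_rsg T Y \<alpha>) b \<cdot>\<^bsub>W_rsg T Y \<alpha>\<^esub> a"
    unfolding permissible_def order_ideal_def by blast+
  obtain t y where ty: "(t, y) \<in> A" using ne by auto
  then have t: "t \<in> carrier T" using sub W_carrier by blast
  have same: "fst a = t" if a: "a \<in> A" for a
  proof -
    have cl: "a \<in> carrier (W_rsg T Y \<alpha>)" "(t, y) \<in> carrier (W_rsg T Y \<alpha>)" using a ty sub by blast+
    have "t = fst (rplus (W_rsg T Y \<alpha>) a \<cdot>\<^bsub>W_rsg T Y \<alpha>\<^esub> (t, y))"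
      using W.cover_projection_mult[OF W.plus_in_projections[OF cl(1)] cl(2)] by simp
    also have "\<dots> = fst a"
      unfolding comp[OF a ty] by (rule W.cover_projection_mult[OF W.plus_in_projections[OF cl(2)] cl(1)])
    finally show ?thesis by simp
  qed
  define I where "I = {x. (t, x) \<in> A}"
  have A: "A = {t} \<times> I" using same by (auto simp: I_def)
  have ran: "\<exists>e. \<alpha> t e = Some x" if "x \<in> I" for x
    using that sub W_carrier unfolding A by blast
  have "semilattice_ideal Y I"
    unfolding semilattice_ideal_def
  proof (intro conjI ballI impI)
    show "I \<subseteq> carrier Y" using ran action_closed[OF t] by blast
    show "I \<noteq> {}" using ne unfolding A by blast
  next
    fix y x assume y: "y \<in> I" and x: "x \<in> carrier Y" "x \<sqsubseteq> y"
    obtain f where f: "\<alpha> t f = Some y" using ran[OF y] by blast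
    have "natural_le (W_rsg T Y \<alpha>) (t, x) (t, y)" using natural_le_W[OF t t f] x by simp
    moreover obtain k where "\<alpha> t k = Some x" using Y.TI_ran_down[OF action_TI[OF t] f x] .
    then have "(t, x) \<in> carrier (W_rsg T Y \<alpha>)" using t W_carrier by blast
    ultimately have "(t, x) \<in> A" using down y unfolding A by blast
    then show "x \<in> I" unfolding A by blast
  qed
  moreover have "I \<subseteq> ran (\<alpha> t)" using ran by (auto simp: in_ran_iff)
  ultimately show "\<exists>t I. t \<in> carrier T \<and> semilattice_ideal Y I \<and> I \<subseteq> ran (\<alpha> t) \<and> A = {t} \<times> I"
    using t A by blast
next
  assume "\<exists>t I. t \<in> carrier T \<and> semilattice_ideal Y I \<and> I \<subseteq> ran (\<alpha> t) \<and> A = {t} \<times> I"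
  then obtain t I where t: "t \<in> carrier T" and I: "semilattice_ideal Y I" "I \<subseteq> ran (\<alpha> t)"
    and A: "A = {t} \<times> I" by blast
  have sub: "A \<subseteq> carrier (W_rsg T Y \<alpha>)"
    using t I(2) W_carrier unfolding A by (auto simp: subset_iff in_ran_iff)
  have "order_ideal (W_rsg T Y \<alpha>) A"
    unfolding order_ideal_def
  proof (intro conjI ballI impI sub)
    show "A \<noteq> {}" using I unfolding A semilattice_ideal_def by blast
  next
    fix a b assume "b \<in> A" "a \<in> carrier (W_rsg T Y \<alpha>)" and le: "natural_le (W_rsg T Y \<alpha>) a b"
    then obtain u x y where ab: "a = (u, x)" "b = (t, y)" "u \<in> carrier T" "y \<in> I"
      using W_carrier unfolding A by (cases a) blast
    then obtain f where "\<alpha> t f = Some y" using I by (auto simp: subset_iff in_ran_iff)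
    then have "u = t \<and> x \<in> carrier Y \<and> x \<sqsubseteq> y" using natural_le_W[OF ab(3) t] le ab by blast
    then show "a \<in> A" using Y.ideal_down_closed[OF I(1) ab(4)] ab unfolding A by blast
  qed
  moreover have "a \<in> carrier (W_rsg T Y \<alpha>)" "fst a = t" if "a \<in> A" for a
    using that sub unfolding A by auto
  ultimately show "permissible (W_rsg T Y \<alpha>) A"
    unfolding permissible_def
    by (simp add: W.compatible_if_same_cover W.compatible_star_if_same_cover)
qed

text \<open>The range is recorded because the second coordinates of elements of \<open>W_rsg\<close>
  are values of the action.\<close>

definition maps_to_C :: "('y \<rightharpoonup> 'y) \<times> 't \<Rightarrow> ('t \<times> 'y) set" where
  "maps_to_C = (\<lambda>(\<beta>, t). {t} \<times> ran \<beta>)"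

lemma maps_to_C_iso:
  "maps_to_C \<in> rsg_iso (restriction_rsg (TI_set Y) T \<alpha>) (C_monoid (W_rsg T Y \<alpha>))"
proof -
  let ?W = "W_rsg T Y \<alpha>" and ?X = "restriction_rsg (TI_set Y) T \<alpha>"
  let ?C = "C_monoid ?W"
  have X: "\<exists>\<beta> t. p = (\<beta>, t) \<and> \<beta> \<in> TI_set Y \<and> t \<in> carrier T \<and> \<beta> \<subseteq>\<^sub>m \<alpha> t" if "p \<in> carrier ?X" for p
    using that by (auto simp: restriction_rsg_def)
  have "inj_on maps_to_C (carrier ?X)"
  proof (rule inj_onI)
    fix p q assume "p \<in> carrier ?X" "q \<in> carrier ?X" and eq: "maps_to_C p = maps_to_C q"
    then obtain \<beta> t \<gamma> u where p: "p = (\<beta>, t)" "\<beta> \<in> TI_set Y" "t \<in> carrier T" "\<beta> \<subseteq>\<^sub>m \<alpha> t"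
      and q: "q = (\<gamma>, u)" "\<gamma> \<in> TI_set Y" "u \<in> carrier T" "\<gamma> \<subseteq>\<^sub>m \<alpha> u" using X by metis
    \<comment> \<open>Nonemptiness allows both factors to be recovered from the product set.\<close>
    have "ran \<beta> \<noteq> {}" using Y.TI_ran_ideal[OF p(2)] by (simp add: semilattice_ideal_def)
    then have "t = u" "ran \<beta> = ran \<gamma>" using eq by (auto simp: p(1) q(1) maps_to_C_def times_eq_iff)
    then show "p = q" using map_le_same_ran[OF XI.action_inj[OF p(3)] p(4)] p q by simp
  qed
  moreover have "maps_to_C ` carrier ?X = carrier ?C"
  proof (intro equalityI subsetI)
    fix A assume "A \<in> maps_to_C ` carrier ?X"
    then obtain \<beta> t where p: "A = {t} \<times> ran \<beta>" "\<beta> \<in> TI_set Y" "t \<in> carrier T" "\<beta> \<subseteq>\<^sub>m \<alpha> t"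
      using X by (auto simp: maps_to_C_def)
    have "ran \<beta> \<subseteq> ran (\<alpha> t)"
      using p(4) unfolding map_le_iff in_ran_iff subset_iff by blast
    then show "A \<in> carrier ?C"
      using p Y.TI_ran_ideal[OF p(2)] by (auto simp: C_monoid_def permissible_W_iff)
  next
    fix A assume "A \<in> carrier ?C"
    then obtain t I where t: "t \<in> carrier T" and I: "semilattice_ideal Y I" "I \<subseteq> ran (\<alpha> t)"
      and A: "A = {t} \<times> I" by (auto simp: C_monoid_def permissible_W_iff)
    \<comment> \<open>\<open>\<alpha> t\<close> cut down to values in \<open>I\<close>; its range is
      all of \<open>I\<close> since \<open>I \<subseteq> ran (\<alpha> t)\<close>.\<close>
    let ?\<beta> = "pcomp (\<alpha> t) (Some |` I)"
    have "?\<beta> \<in> TI_set Y" using TI.pcomp_closed action_TI[OF t] Y.TI_identity[OF I(1)] by blast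
    moreover have "?\<beta> \<subseteq>\<^sub>m \<alpha> t" by (auto simp: map_le_iff partial_map_simps)
    moreover have "ran ?\<beta> = I"
      using I(2) by (auto simp: set_eq_iff subset_iff partial_map_simps)
    ultimately have "A = maps_to_C (?\<beta>, t)" "(?\<beta>, t) \<in> carrier ?X"
      using A t by (simp_all add: maps_to_C_def restriction_rsg_def)
    then show "A \<in> maps_to_C ` carrier ?X" by blast
  qed
  moreover have "maps_to_C (p \<cdot>\<^bsub>?X\<^esub> q) = maps_to_C p \<cdot>\<^bsub>?C\<^esub> maps_to_C q"
    if pq: "p \<in> carrier ?X" "q \<in> carrier ?X" for p q
  proof -
    obtain \<beta> t \<gamma> u where p: "p = (\<beta>, t)" "\<beta> \<in> TI_set Y" "t \<in> carrier T" "\<beta> \<subseteq>\<^sub>m \<alpha> t"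
      and q: "q = (\<gamma>, u)" "\<gamma> \<in> TI_set Y" "u \<in> carrier T" "\<gamma> \<subseteq>\<^sub>m \<alpha> u" using X pq by metis
    have "{t \<otimes>\<^bsub>T\<^esub> u} \<times> ran (pcomp \<beta> \<gamma>) = {a \<cdot>\<^bsub>?W\<^esub> b | a b. a \<in> {t} \<times> ran \<beta> \<and> b \<in> {u} \<times> ran \<gamma>}"
      (is "?l = ?r")
    proof (intro equalityI subsetI)
      fix c assume "c \<in> ?l"
      then obtain e x z where c: "c = (t \<otimes>\<^bsub>T\<^esub> u, z)" "\<beta> e = Some x" "\<gamma> x = Some z"
        by (auto simp: partial_map_simps)
      then have ex: "\<alpha> t e = Some x" "\<alpha> u x = Some z" using p q by (auto simp: map_le_iff)
      \<comment> \<open>A value \<open>z\<close> of the composite is reached by multiplying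
        \<open>(t, x)\<close> with \<open>(u, z)\<close>; the argument of the second factor is again
        \<open>x\<close>, so the product formula involves \<open>x \<sqinter> x\<close>.\<close>
      have "x \<sqinter> x = x" using action_closed[OF p(3) ex(1)] Y.le_iff_meet_eq by blast
      then have "c = (t, x) \<cdot>\<^bsub>?W\<^esub> (u, z)"
        using W_mult[OF p(3) ex(1) q(3) ex(2)] ex c by (metis option.inject)
      moreover have "x \<in> ran \<beta>" "z \<in> ran \<gamma>" using c by (auto simp: in_ran_iff)
      ultimately show "c \<in> ?r" by blast
    next
      fix c assume "c \<in> ?r"
      then obtain x g where c: "c = (t, x) \<cdot>\<^bsub>?W\<^esub> (u, g)" "x \<in> ran \<beta>" "g \<in> ran \<gamma>" by auto
      then obtain e f where ef: "\<beta> e = Some x" "\<gamma> f = Some g" by (auto simp: in_ran_iff)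
      then have ef': "\<alpha> t e = Some x" "\<alpha> u f = Some g" using p q by (auto simp: map_le_iff)
      obtain z where z: "\<alpha> u (x \<sqinter> f) = Some z" "c = (t \<otimes>\<^bsub>T\<^esub> u, z)"
        using W_mult[OF p(3) ef'(1) q(3) ef'(2)] c by metis
      \<comment> \<open>\<open>ran \<beta>\<close> and \<open>dom \<gamma>\<close> are ideals
        containing \<open>x\<close> and \<open>f\<close> respectively, so
        \<open>x \<sqinter> f\<close> lies in both and the product comes from \<open>\<beta>\<close>
        and \<open>\<gamma>\<close> themselves, not merely from the action.\<close>
      have "x \<in> carrier Y" "f \<in> carrier Y" using action_closed p q ef' by blast+
      then have "x \<sqinter> f \<in> ran \<beta>" "x \<sqinter> f \<in> dom \<gamma>"
        using Y.ideal_meet Y.TI_ran_ideal[OF p(2)] Y.TI_dom_ideal[OF q(2)] c(2) ef by blast+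
      then obtain k w where k: "\<beta> k = Some (x \<sqinter> f)" "\<gamma> (x \<sqinter> f) = Some w" by (auto simp: in_ran_iff)
      then have "w = z" using q(4) z by (simp add: map_le_iff)
      then show "c \<in> ?l" using k z by (auto simp: partial_map_simps)
    qed
    then show ?thesis by (simp add: p(1) q(1) maps_to_C_def restriction_rsg_def C_monoid_def)
  qed
  moreover have "maps_to_C (rplus ?X p) = rplus ?C (maps_to_C p) \<and>
      maps_to_C (rstar ?X p) = rstar ?C (maps_to_C p)" if p: "p \<in> carrier ?X" for p
  proof -
    obtain \<beta> t where p: "p = (\<beta>, t)" "\<beta> \<in> TI_set Y" "t \<in> carrier T" "\<beta> \<subseteq>\<^sub>m \<alpha> t"
      using X p by metis
    have ran: "ran (Some |` D) = D" for D :: "'y set" by (auto simp: set_eq_iff partial_map_simps)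
    have pre: "rplus ?W (t, x) = (\<one>\<^bsub>T\<^esub>, e)" if "\<beta> e = Some x" for e x
      using that p(4) W_plus[OF p(3)] by (simp add: map_le_iff)
    have "rplus ?W ` ({t} \<times> ran \<beta>) = {\<one>\<^bsub>T\<^esub>} \<times> dom \<beta>"
    proof (intro equalityI subsetI)
      fix c assume "c \<in> rplus ?W ` ({t} \<times> ran \<beta>)"
      then obtain e x where "\<beta> e = Some x" "c = rplus ?W (t, x)" by (auto simp: in_ran_iff)
      then show "c \<in> {\<one>\<^bsub>T\<^esub>} \<times> dom \<beta>" using pre by auto
    next
      fix c assume "c \<in> {\<one>\<^bsub>T\<^esub>} \<times> dom \<beta>"
      then obtain e x where e: "c = (\<one>\<^bsub>T\<^esub>, e)" "\<beta> e = Some x" by auto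
      then have "c = rplus ?W (t, x)" using pre by simp
      moreover have "x \<in> ran \<beta>" using e by (auto simp: in_ran_iff)
      ultimately show "c \<in> rplus ?W ` ({t} \<times> ran \<beta>)" by blast
    qed
    moreover have "rstar ?W ` ({t} \<times> ran \<beta>) = {\<one>\<^bsub>T\<^esub>} \<times> ran \<beta>"
      by (auto simp: W_star image_iff)
    ultimately show ?thesis
      by (simp add: p(1) maps_to_C_def restriction_rsg_def C_monoid_def ran)
  qed
  ultimately show ?thesis by (simp add: rsg_iso_def bij_betw_def)
qed

section \<open>Comparison with the subsemigroups of the product, and the criteria\<close>

lemma restriction_rsg_TP_T_TI: "id \<in> rsg_iso (restriction_rsg (TP_set Y) T \<alpha>) (TP_T_TI T Y \<alpha>)"
  unfolding rsg_iso_def TP_T_TI_def rsg_prod_def TP_rsg_def plain_rsg_def TI_rsg_def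
  by (auto simp: restriction_rsg_def TP.rplus_inverse_rsg TP.rstar_inverse_rsg bij_betw_def
      TI.natural_le_inverse_rsg action_TI Y.TP_imp_TI) (auto simp: inverse_rsg_def)

text \<open>The assumption puts each \<open>\<alpha> t\<close> in \<open>TP_set Y\<close>, where the
  order of \<open>TP_rsg Y\<close> is inclusion of maps; the carrier then agrees with that of
  \<open>TP_T_TI\<close>.\<close>

lemma restriction_rsg_TP_T:
  assumes "\<alpha> \<in> carrier T \<rightarrow> TP_set Y"
  shows "id \<in> rsg_iso (restriction_rsg (TP_set Y) T \<alpha>) (TP_T T Y \<alpha>)"
  using assms unfolding rsg_iso_def TP_T_def rsg_prod_def TP_rsg_def plain_rsg_def
  by (auto simp: restriction_rsg_def TP.rplus_inverse_rsg TP.rstar_inverse_rsg bij_betw_def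
      TP.natural_le_inverse_rsg Pi_iff) (auto simp: inverse_rsg_def)

text \<open>In the monoid of permissible subsets the greatest element over \<open>t\<close>
  corresponds to \<open>(\<alpha> t, t)\<close>, so the criterion is multiplicativity of
  \<open>\<alpha>\<close>. Preservation of the identity, which \<open>hom\<close> does not mention,
  is part of \<open>monoidal_subhom\<close>.\<close>

lemma almost_T_proper_W_iff: "almost_T_proper T (W_rsg T Y \<alpha>) \<longleftrightarrow> \<alpha> \<in> hom T (TI_monoid Y)"
  unfolding almost_T_proper_def using W_restriction_semigroup action_TI
  by (auto simp: XI.T_proper_iso_iff[OF action_TI maps_to_C_iso] hom_def TI_monoid_def)

text \<open>Here each \<open>\<alpha> t\<close> belongs to the family that models
  \<open>W_rsg\<close>, so the greatest elements \<open>(\<alpha> t, t)\<close> are already present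
  there.\<close>

lemma F_restriction_W:
  assumes "\<alpha> \<in> carrier T \<rightarrow> TP_set Y" shows "F_restriction (W_rsg T Y \<alpha>)"
  using F_cover.F_restriction[OF F_cover_iso[OF XP.F_cover maps_to_W_iso]] assms by blast

lemma T_proper_W_iff:
  assumes "\<alpha> \<in> carrier T \<rightarrow> TP_set Y"
  shows "T_proper T (W_rsg T Y \<alpha>) \<longleftrightarrow> \<alpha> \<in> hom T (TP_monoid Y)"
  using XP.T_proper_iso_iff[OF _ maps_to_W_iso] assms
  by (auto simp: hom_def TP_monoid_def TI_monoid_def Pi_iff)

end

theorem theorem9p2:
  fixes T :: "('t, 'c) monoid_scheme"
    and Y :: "('y, 'w) gorder_scheme"
    and \<alpha> :: "'t \<Rightarrow> ('y \<rightharpoonup> 'y)"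
  assumes "monoid T"
    and "lower_semilattice Y"
    and "monoidal_subhom T Y \<alpha>"
  shows "rsg_isomorphic (W_rsg T Y \<alpha>) (TP_T_TI T Y \<alpha>) \<and>
         proper (W_rsg T Y \<alpha>) \<and>
         (\<exists>\<phi>. bij_betw \<phi> (projections (W_rsg T Y \<alpha>)) (carrier Y) \<and>
            (\<forall>p\<in>projections (W_rsg T Y \<alpha>). \<forall>q\<in>projections (W_rsg T Y \<alpha>).
               \<phi> (p \<cdot>\<^bsub>W_rsg T Y \<alpha>\<^esub> q) = \<phi> p \<sqinter>\<^bsub>Y\<^esub> \<phi> q)) \<and>
         rsg_isomorphic (sigma_quotient (W_rsg T Y \<alpha>)) (plain_rsg T) \<and>
         (almost_T_proper T (W_rsg T Y \<alpha>) \<longleftrightarrow> \<alpha> \<in> hom T (TI_monoid Y)) \<and>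
         ((\<exists>e\<in>carrier Y. \<forall>y\<in>carrier Y. e \<sqinter>\<^bsub>Y\<^esub> y = y) \<and> \<alpha> \<in> carrier T \<rightarrow> TP_set Y \<longrightarrow>
            rsg_isomorphic (W_rsg T Y \<alpha>) (TP_T T Y \<alpha>) \<and>
            F_restriction (W_rsg T Y \<alpha>) \<and>
            (T_proper T (W_rsg T Y \<alpha>) \<longleftrightarrow> \<alpha> \<in> hom T (TP_monoid Y)))"
proof -
  interpret semilattice_subaction Y T \<alpha>
    using assms by (simp add: semilattice_subaction_def semilattice_subaction_axioms_def)
  have "rsg_isomorphic (W_rsg T Y \<alpha>) (TP_T_TI T Y \<alpha>)"
    using rsg_isomorphicI[OF rsg_iso_comp[OF W_to_maps_iso restriction_rsg_TP_T_TI]] .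
  moreover have "rsg_isomorphic (W_rsg T Y \<alpha>) (TP_T T Y \<alpha>)" if "\<alpha> \<in> carrier T \<rightarrow> TP_set Y"
    using rsg_isomorphicI[OF rsg_iso_comp[OF W_to_maps_iso restriction_rsg_TP_T[OF that]]] .
  ultimately show ?thesis
    using W.proper projections_W_semilattice W.sigma_quotient_isomorphic almost_T_proper_W_iff
      F_restriction_W T_proper_W_iff by (intro conjI impI) simp_all
qed

end
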